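(* Let $n$ be a positive integer and let $\mathcal{E}$ be the set of (isometry classes of) additively indecomposable lattices of rank $n$. If $|\mathcal{E}|>0$, then every $n$-criterion set must include at least one lattice $E\in\mathcal{E}$.
   Context: A lattice means a positive-definite integral $\mathbb{Z}$-lattice: a free $\mathbb{Z}$-module $L$ of finite rank equipped with a positive-definite symmetric bilinear form $B(\cdot,\cdot)$ with $B(L,L)\subseteq\mathbb{Z}$. Equivalently, it is given by a positive-definite symmetric integer Gram matrix (a positive-definite integer-matrix quadratic form). Lattices are considered up to isometry. A lattice $L$ represents a lattice $\ell$ if there exists a $\mathbb{Z}$-linear injection $\ell\to L$ preserving the bilinear forms. A lattice is $n$-universal if it represents all lattices of rank $n$. An $n$-criterion set is a set $\mathcal{S}$ of rank-$n$ lattices having the property that, for every lattice $L$, $L$ is $n$-universal if and only if $L$ represents every lattice in $\mathcal{S}$. $L_1\bot L_2$ denotes the orthogonal direct sum of lattices $L_1,L_2$. For a sublattice $\ell=\mathbb{Z}(\mathbf{x}_{1,1}+\mathbf{x}_{2,1})+\cdots+\mathbb{Z}(\mathbf{x}_{1,m}+\mathbf{x}_{2,m})$ of $L_1\bot L_2$ with $\mathbf{x}_{i,j}\in L_i$, write $\ell(L_i):=\mathbb{Z}\mathbf{x}_{i,1}+\cdots+\mathbb{Z}\mathbf{x}_{i,m}$ (the image of $\ell$ under the projection to $L_i$); this notation extends to a lattice $\ell$ represented by $L_1\bot L_2$, via its image under the representation. A lattice $\ell$ is additively indecomposable if, whenever $L_1\bot L_2$ represents $\ell$ (for any lattices $L_1,L_2$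 and any representation $\ell\to L_1\bot L_2$), either $\ell(L_1)=0$ or $\ell(L_2)=0$. Otherwise $\ell$ is additively decomposable. *)

theory Defs
  imports "Jordan_Normal_Form.Matrix"
begin

(* A free Z-module of rank n with a chosen basis is identified with Z^n, i.e. with
   "carrier_vec n :: int vec set"; the bilinear form is then recorded by its Gram matrix.
   Different matrices may describe isometric lattices; all notions below are
   invariant under isometry. *)

abbreviation lat_rank :: "int mat \<Rightarrow> nat" where
  "lat_rank G \<equiv> dim_row G"

definition lat_vecs :: "int mat \<Rightarrow> int vec set" where
  "lat_vecs G = carrier_vec (lat_rank G)"

definition lat_form :: "int mat \<Rightarrow> int vec \<Rightarrow> int vec \<Rightarrow> int" where
  "lat_form G x y = x \<bullet> (G *\<^sub>v y)"

(* Positivity is required on the integral vectors only; by clearing denominators this is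
   positive definiteness over the rationals, and hence over the reals. *)
definition is_lattice :: "int mat \<Rightarrow> bool" where
  "is_lattice G \<longleftrightarrow> square_mat G \<and> transpose_mat G = G \<and>
     (\<forall>x \<in> lat_vecs G. x \<noteq> 0\<^sub>v (lat_rank G) \<longrightarrow> lat_form G x x > 0)"

(* f represents the lattice l by the lattice L. *)
definition is_representation :: "int mat \<Rightarrow> int mat \<Rightarrow> (int vec \<Rightarrow> int vec) \<Rightarrow> bool" where
  "is_representation l L f \<longleftrightarrow>
     f ` lat_vecs l \<subseteq> lat_vecs L \<and>
     (\<forall>x \<in> lat_vecs l. \<forall>y \<in> lat_vecs l. f (x + y) = f x + f y) \<and>
     (\<forall>c. \<forall>x \<in> lat_vecs l. f (c \<cdot>\<^sub>v x) = c \<cdot>\<^sub>v f x) \<and>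
     inj_on f (lat_vecs l) \<and>
     (\<forall>x \<in> lat_vecs l. \<forall>y \<in> lat_vecs l. lat_form L (f x) (f y) = lat_form l x y)"

definition represents :: "int mat \<Rightarrow> int mat \<Rightarrow> bool" where
  "represents L l \<longleftrightarrow> (\<exists>f. is_representation l L f)"

definition n_universal :: "nat \<Rightarrow> int mat \<Rightarrow> bool" where
  "n_universal n L \<longleftrightarrow> (\<forall>l. is_lattice l \<and> lat_rank l = n \<longrightarrow> represents L l)"

definition criterion_set :: "nat \<Rightarrow> int mat set \<Rightarrow> bool" where
  "criterion_set n S \<longleftrightarrow>
     (\<forall>l \<in> S. is_lattice l \<and> lat_rank l = n) \<and>
     (\<forall>L. is_lattice L \<longrightarrow> (n_universal n L \<longleftrightarrow> (\<forall>l \<in> S. represents L l)))"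

definition orth_sum :: "int mat \<Rightarrow> int mat \<Rightarrow> int mat" where
  "orth_sum L1 L2 = four_block_mat
     L1 (0\<^sub>m (lat_rank L1) (lat_rank L2))
     (0\<^sub>m (lat_rank L2) (lat_rank L1)) L2"

(* A vector of the orthogonal sum is the concatenation of its components in L1 and L2. *)
lemma lat_form_orth_sum:
  assumes "is_lattice L1" "is_lattice L2"
    and "x1 \<in> lat_vecs L1" "y1 \<in> lat_vecs L1" "x2 \<in> lat_vecs L2" "y2 \<in> lat_vecs L2"
  shows "lat_form (orth_sum L1 L2) (x1 @\<^sub>v x2) (y1 @\<^sub>v y2) =
         lat_form L1 x1 y1 + lat_form L2 x2 y2"
proof -
  have c1: "L1 \<in> carrier_mat (lat_rank L1) (lat_rank L1)"
    using assms(1) unfolding is_lattice_def square_mat.simps by (intro carrier_matI) blast+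
  have c2: "L2 \<in> carrier_mat (lat_rank L2) (lat_rank L2)"
    using assms(2) unfolding is_lattice_def square_mat.simps by (intro carrier_matI) blast+
  have x1: "x1 \<in> carrier_vec (lat_rank L1)" and y1: "y1 \<in> carrier_vec (lat_rank L1)"
    and x2: "x2 \<in> carrier_vec (lat_rank L2)" and y2: "y2 \<in> carrier_vec (lat_rank L2)"
    using assms(3-6) unfolding lat_vecs_def by blast+
  have z1: "0\<^sub>m (lat_rank L1) (lat_rank L2) *\<^sub>v y2 = 0\<^sub>v (lat_rank L1)"
    using y2 by (intro eq_vecI) auto
  have z2: "0\<^sub>m (lat_rank L2) (lat_rank L1) *\<^sub>v y1 = 0\<^sub>v (lat_rank L2)"
    using y1 by (intro eq_vecI) auto
  have m1: "L1 *\<^sub>v y1 \<in> carrier_vec (lat_rank L1)"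
    using c1 y1 by (rule mult_mat_vec_carrier)
  have m2: "L2 *\<^sub>v y2 \<in> carrier_vec (lat_rank L2)"
    using c2 y2 by (rule mult_mat_vec_carrier)
  have "orth_sum L1 L2 *\<^sub>v (y1 @\<^sub>v y2) = (L1 *\<^sub>v y1) @\<^sub>v (L2 *\<^sub>v y2)"
    unfolding orth_sum_def four_block_mat_mult_vec[OF c1 zero_carrier_mat zero_carrier_mat c2 y1 y2]
      z1 z2 right_zero_vec[OF m1] left_zero_vec[OF m2] ..
  then show ?thesis
    unfolding lat_form_def by (simp only: scalar_prod_append[OF x1 x2 m1 m2])
qed

(* The images of l in the two summands under a representation f of l by an orthogonal sum. *)
definition proj_image1 :: "int mat \<Rightarrow> (int vec \<Rightarrow> int vec) \<Rightarrow> int mat \<Rightarrow> int vec set" where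
  "proj_image1 l f L1 = (\<lambda>x. vec_first (f x) (lat_rank L1)) ` lat_vecs l"

definition proj_image2 :: "int mat \<Rightarrow> (int vec \<Rightarrow> int vec) \<Rightarrow> int mat \<Rightarrow> int vec set" where
  "proj_image2 l f L2 = (\<lambda>x. vec_last (f x) (lat_rank L2)) ` lat_vecs l"

definition additively_indecomposable :: "int mat \<Rightarrow> bool" where
  "additively_indecomposable l \<longleftrightarrow>
     (\<forall>L1 L2 f. is_lattice L1 \<and> is_lattice L2 \<and> is_representation l (orth_sum L1 L2) f \<longrightarrow>
        proj_image1 l f L1 = {0\<^sub>v (lat_rank L1)} \<or> proj_image2 l f L2 = {0\<^sub>v (lat_rank L2)})"

definition indecomposables :: "nat \<Rightarrow> int mat set" where
  "indecomposables n = {E. is_lattice E \<and> lat_rank E = n \<and> additively_indecomposable E}"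

end

theory Submission
  imports Defs "HOL-Computational_Algebra.Primes" "Jordan_Normal_Form.Determinant"
begin

text \<open>
  Fix an additively indecomposable lattice \<open>E\<close> of rank \<open>n\<close>. A decomposable lattice \<open>l\<close> of rank \<open>n\<close>
  never represents \<open>E\<close>: the image of \<open>E\<close> in \<open>l\<close> has finite index, so a representation of \<open>l\<close> by an
  orthogonal sum whose two projections are nonzero restricts to a representation of \<open>E\<close> with the
  same property (\<open>decomposable_not_represents\<close>). Moreover an orthogonal sum represents \<open>E\<close> only if
  one of its summands does (\<open>indecomposable_orth_sum\<close>). For a finite set \<open>S\<close> of decomposable
  lattices of rank \<open>n\<close> this settles the matter: the orthogonal sum of the members of \<open>S\<close> represents
  all of \<open>S\<close> but not \<open>E\<close>, so \<open>S\<close> is not an \<open>n\<close>-criterion set.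

  A criterion set may be infinite, however, and then a single lattice of finite rank is needed which
  represents every lattice of rank \<open>n\<close> that does not represent \<open>E\<close>, and still does not represent \<open>E\<close>
  itself (\<open>ex_lattice_avoiding\<close>). The finiteness comes from reduction theory. Every positive
  definite integral form is integrally equivalent to a reduced form (\<open>ex_reduced_form\<close>), and all
  reduced forms lie in a cone spanned by finitely many forms \<open>v v\<^sup>T\<close> with \<open>v\<close> an integral vector
  (\<open>reduced_form_in_cone\<close>). Given a reduced form \<open>\<Sum> \<lambda>\<^sub>v v v\<^sup>T\<close>, write \<open>\<lambda>\<^sub>v = 2 b\<^sub>v + r\<^sub>v\<close> with a natural
  number \<open>b\<^sub>v\<close> and \<open>0 \<le> r\<^sub>v \<le> 4\<close>, in such a way that \<open>r\<^sub>v > 0\<close> if \<open>\<lambda>\<^sub>v > 0\<close>, and \<open>r\<^sub>v \<ge> 2\<close> if \<open>b\<^sub>v > 0\<close>.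

  \<^item> By Lagrange's theorem on four squares, \<open>\<Sum> 2 b\<^sub>v v v\<^sup>T\<close> comes from a linear map into an orthogonal
    sum of four copies of \<open>\<langle>2\<rangle>\<close> for each \<open>v\<close>. The lattice \<open>\<langle>2\<rangle>\<close> is the diagonal of \<open>\<langle>1\<rangle> \<bottom> \<langle>1\<rangle>\<close>, and
    therefore does not represent \<open>E\<close>.
  \<^item> The remainder \<open>R = \<Sum> r\<^sub>v v v\<^sup>T\<close> is an integral matrix with bounded entries, so there are only
    finitely many possibilities for it. It is positive definite because it has the same support as
    the reduced form. If some \<open>b\<^sub>v v \<noteq> 0\<close>, then \<open>R - v v\<^sup>T\<close> is positive definite as well, which
    makes \<open>R\<close> decomposable; otherwise \<open>R\<close> is equivalent to the given lattice. Either way \<open>R\<close> does not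
    represent \<open>E\<close>.

  The orthogonal sum of these finitely many lattices has the required property.
\<close>

section \<open>Sums of four squares\<close>

definition sum_of_four_squares :: "int \<Rightarrow> bool" where
  "sum_of_four_squares n \<longleftrightarrow> (\<exists>a b c d. n = a\<^sup>2 + b\<^sup>2 + c\<^sup>2 + d\<^sup>2)"

lemma euler_four_squares:
  fixes a b c d w x y z :: "'a::comm_ring_1"
  shows "(a\<^sup>2 + b\<^sup>2 + c\<^sup>2 + d\<^sup>2) * (w\<^sup>2 + x\<^sup>2 + y\<^sup>2 + z\<^sup>2) =
    (a*w + b*x + c*y + d*z)\<^sup>2 + (a*x - b*w + c*z - d*y)\<^sup>2 +
    (a*y - c*w + d*x - b*z)\<^sup>2 + (a*z - d*w + b*y - c*x)\<^sup>2"
  by (simp add: power2_eq_square algebra_simps)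

lemma sum_of_four_squares_mult:
  assumes "sum_of_four_squares m" "sum_of_four_squares n"
  shows "sum_of_four_squares (m * n)"
  using assms unfolding sum_of_four_squares_def by (metis euler_four_squares)

lemma ex_centered_residue:
  fixes a m :: int
  assumes "m > 0"
  shows "\<exists>r k. a = r + m * k \<and> 2 * \<bar>r\<bar> \<le> m"
proof (cases "2 * (a mod m) \<le> m")
  case True
  then show ?thesis
    using assms by (intro exI[of _ "a mod m"] exI[of _ "a div m"]) auto
next
  case False
  have "a = (a mod m - m) + m * (a div m + 1)"
    by (simp add: algebra_simps)
  moreover have "2 * \<bar>a mod m - m\<bar> \<le> m"
    using False pos_mod_bound[OF assms, of a] by (simp add: abs_if)
  ultimately show ?thesis by blast
qed

lemma square_le_of_centered:
  fixes r m :: int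
  assumes "2 * \<bar>r\<bar> \<le> m"
  shows "4 * r\<^sup>2 \<le> m\<^sup>2"
proof -
  have "(2 * \<bar>r\<bar>)\<^sup>2 \<le> m\<^sup>2" using assms by (intro power_mono) auto
  then show ?thesis by (simp add: power_mult_distrib)
qed

text \<open>
  Lagrange's descent. Replace the four numbers by their centered residues modulo \<open>m\<close>; the squares
  of the residues sum to \<open>m r\<close> with \<open>r \<le> m\<close>, and Euler's identity turns the product of the two sums
  into \<open>m\<^sup>2\<close> times a representation of \<open>r p\<close>. The extreme cases \<open>r = 0\<close> and \<open>r = m\<close> would make \<open>m\<close>
  divide \<open>p\<close>.
\<close>
lemma four_squares_descent:
  fixes m p :: int
  assumes p: "prime p" and m: "1 < m" "m < p" and s: "sum_of_four_squares (m * p)"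
  shows "\<exists>r. 0 < r \<and> r < m \<and> sum_of_four_squares (r * p)"
proof -
  obtain a b c d where e: "m * p = a\<^sup>2 + b\<^sup>2 + c\<^sup>2 + d\<^sup>2"
    using s unfolding sum_of_four_squares_def by blast
  have m0: "m > 0" using m by simp
  obtain w k1 where w: "a = w + m * k1" "2 * \<bar>w\<bar> \<le> m" using ex_centered_residue[OF m0] by blast
  obtain x k2 where x: "b = x + m * k2" "2 * \<bar>x\<bar> \<le> m" using ex_centered_residue[OF m0] by blast
  obtain y k3 where y: "c = y + m * k3" "2 * \<bar>y\<bar> \<le> m" using ex_centered_residue[OF m0] by blast
  obtain z k4 where z: "d = z + m * k4" "2 * \<bar>z\<bar> \<le> m" using ex_centered_residue[OF m0] by blast
  have not_dvd: "\<not> m\<^sup>2 dvd m * p"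
  proof
    assume "m\<^sup>2 dvd m * p"
    then have "m dvd p" using m0 by (simp add: power2_eq_square)
    moreover have "\<forall>m. 0 \<le> m \<and> m dvd p \<longrightarrow> m = 1 \<or> m = p"
      using p unfolding prime_int_iff by blast
    ultimately have "m = 1 \<or> m = p" using m0 by simp
    then show False using m by simp
  qed
  \<comment> \<open>this is \<open>(w\<^sup>2 + x\<^sup>2 + y\<^sup>2 + z\<^sup>2) / m\<close>, written without division\<close>
  define r where "r = p - 2 * (w*k1 + x*k2 + y*k3 + z*k4) - m * (k1\<^sup>2 + k2\<^sup>2 + k3\<^sup>2 + k4\<^sup>2)"
  have r: "m * r = w\<^sup>2 + x\<^sup>2 + y\<^sup>2 + z\<^sup>2"
    using e unfolding r_def w(1) x(1) y(1) z(1) by (simp add: power2_eq_square algebra_simps)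
  have bounds: "4 * w\<^sup>2 \<le> m\<^sup>2" "4 * x\<^sup>2 \<le> m\<^sup>2" "4 * y\<^sup>2 \<le> m\<^sup>2" "4 * z\<^sup>2 \<le> m\<^sup>2"
    using w x y z square_le_of_centered by blast+
  have "r \<ge> 0"
  proof -
    have "0 \<le> m * r" unfolding r by simp
    then show ?thesis using m0 by (simp add: zero_le_mult_iff)
  qed
  moreover have "r \<noteq> 0"
  proof
    assume "r = 0"
    then have "w\<^sup>2 + x\<^sup>2 + y\<^sup>2 + z\<^sup>2 = 0" using r by simp
    then have "w = 0 \<and> x = 0 \<and> y = 0 \<and> z = 0"
      by (smt (verit, best) zero_le_power2 power2_eq_iff_nonneg zero_eq_power2)
    then have "m * p = m\<^sup>2 * (k1\<^sup>2 + k2\<^sup>2 + k3\<^sup>2 + k4\<^sup>2)"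
      unfolding e w(1) x(1) y(1) z(1) by (simp add: power2_eq_square algebra_simps)
    then show False using not_dvd by simp
  qed
  moreover have "r \<le> m"
  proof -
    have "m * r \<le> m * m" using r bounds by (simp add: power2_eq_square)
    then show ?thesis using m0 by simp
  qed
  moreover have "r \<noteq> m"
  proof
    assume rm: "r = m"
    \<comment> \<open>all four residues are \<open>\<plusminus>m/2\<close>, and their cross terms with the quotients are multiples of \<open>m\<close>\<close>
    then have "4 * w\<^sup>2 = m\<^sup>2" "4 * x\<^sup>2 = m\<^sup>2" "4 * y\<^sup>2 = m\<^sup>2" "4 * z\<^sup>2 = m\<^sup>2"
      using r bounds by (auto simp: power2_eq_square)
    moreover have half: "m dvd 2 * t" if "4 * t\<^sup>2 = m\<^sup>2" for t
    proof -
      have "(2 * t)\<^sup>2 = m\<^sup>2" using that by (simp add: power_mult_distrib)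
      then have "2 * t = m \<or> 2 * t = - m" by (simp only: power2_eq_iff)
      then show ?thesis by auto
    qed
    ultimately obtain l1 l2 l3 l4 where l: "2 * w = m * l1" "2 * x = m * l2" "2 * y = m * l3" "2 * z = m * l4"
      by (meson dvdE half)
    have "m * p = m * r + m * (2 * w*k1 + 2 * x*k2 + 2 * y*k3 + 2 * z*k4) + m\<^sup>2 * (k1\<^sup>2 + k2\<^sup>2 + k3\<^sup>2 + k4\<^sup>2)"
      unfolding r_def by (simp add: power2_eq_square algebra_simps)
    also have "\<dots> = m\<^sup>2 * (1 + l1 * k1 + l2 * k2 + l3 * k3 + l4 * k4 + k1\<^sup>2 + k2\<^sup>2 + k3\<^sup>2 + k4\<^sup>2)"
      unfolding rm l by (simp add: power2_eq_square algebra_simps)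
    finally show False using not_dvd by simp
  qed
  ultimately have rr: "0 < r" "r < m" by auto
  have "m\<^sup>2 * (r * p) = (m * p) * (m * r)" by (simp add: power2_eq_square)
  also have "\<dots> = (a*w + b*x + c*y + d*z)\<^sup>2 + (a*x - b*w + c*z - d*y)\<^sup>2 +
    (a*y - c*w + d*x - b*z)\<^sup>2 + (a*z - d*w + b*y - c*x)\<^sup>2"
    unfolding e r by (rule euler_four_squares)
  also have "a*w + b*x + c*y + d*z = m * (r + k1*w + k2*x + k3*y + k4*z)"
    using r unfolding w(1) x(1) y(1) z(1) by (simp add: power2_eq_square algebra_simps)
  also have "a*x - b*w + c*z - d*y = m * (k1*x - k2*w + k3*z - k4*y)"
    unfolding w(1) x(1) y(1) z(1) by (simp add: algebra_simps)
  also have "a*y - c*w + d*x - b*z = m * (k1*y - k3*w + k4*x - k2*z)"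
    unfolding w(1) x(1) y(1) z(1) by (simp add: algebra_simps)
  also have "a*z - d*w + b*y - c*x = m * (k1*z - k4*w + k2*y - k3*x)"
    unfolding w(1) x(1) y(1) z(1) by (simp add: algebra_simps)
  finally have "m\<^sup>2 * (r * p) = m\<^sup>2 * ((r + k1*w + k2*x + k3*y + k4*z)\<^sup>2 + (k1*x - k2*w + k3*z - k4*y)\<^sup>2 +
      (k1*y - k3*w + k4*x - k2*z)\<^sup>2 + (k1*z - k4*w + k2*y - k3*x)\<^sup>2)"
    unfolding power_mult_distrib distrib_left[symmetric] .
  then have "sum_of_four_squares (r * p)"
    using m0 unfolding sum_of_four_squares_def by (metis mult_left_cancel power2_less_0 zero_eq_power2 less_irrefl)
  then show ?thesis using rr by blast
qed

text \<open>
  A pigeonhole argument: the residues \<open>x\<^sup>2\<close> and \<open>-1 - y\<^sup>2\<close> for \<open>0 \<le> x, y < p/2\<close> take \<open>(p + 1)/2\<close>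
  values each, so the two sets of values meet. The size of \<open>x\<close> and \<open>y\<close> makes the multiplier
  smaller than \<open>p\<close>, where the descent can start.
\<close>
lemma ex_two_squares_plus_one_multiple:
  fixes p :: int
  assumes p: "prime p" and odd: "odd p"
  shows "\<exists>x y. 0 \<le> x \<and> 2 * x < p \<and> 0 \<le> y \<and> 2 * y < p \<and> p dvd x\<^sup>2 + y\<^sup>2 + 1"
proof -
  define h where "h = (p - 1) div 2"
  have h: "p = 2 * h + 1" using odd unfolding h_def by (auto elim!: oddE)
  have h0: "0 \<le> h" using prime_gt_0_int[OF p] h by simp
  let ?A = "(\<lambda>x. x\<^sup>2 mod p) ` {0..h}" and ?B = "(\<lambda>y. (- y\<^sup>2 - 1) mod p) ` {0..h}"
  have close: "x = y" if "x \<in> {0..h}" "y \<in> {0..h}" "p dvd x\<^sup>2 - y\<^sup>2" for x y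
  proof -
    have "p dvd (x - y) * (x + y)" using that(3) by (simp add: power2_eq_square algebra_simps)
    then have "p dvd x - y \<or> p dvd x + y" using p by (simp add: prime_dvd_mult_iff)
    then show ?thesis
    proof
      assume "p dvd x - y"
      then have "p dvd \<bar>x - y\<bar>" by simp
      moreover have "\<bar>x - y\<bar> < p" using that h by auto
      ultimately show ?thesis using zdvd_not_zless[of "\<bar>x - y\<bar>" p] by fastforce
    next
      assume "p dvd x + y"
      moreover have "x + y < p" using that h by auto
      ultimately have "\<not> 0 < x + y" using zdvd_not_zless[of "x + y" p] by blast
      then show ?thesis using that by auto
    qed
  qed
  have "inj_on (\<lambda>x. x\<^sup>2 mod p) {0..h}"
    by (rule inj_onI) (metis close mod_eq_dvd_iff)
  moreover have "inj_on (\<lambda>y. (- y\<^sup>2 - 1) mod p) {0..h}"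
  proof (rule inj_onI)
    fix x y assume xy: "x \<in> {0..h}" "y \<in> {0..h}" "(- x\<^sup>2 - 1) mod p = (- y\<^sup>2 - 1) mod p"
    have "p dvd y\<^sup>2 - x\<^sup>2" using xy(3) unfolding mod_eq_dvd_iff by simp
    then show "x = y" using close[of y x] xy by simp
  qed
  ultimately have "card ?A = nat (h + 1)" "card ?B = nat (h + 1)"
    by (simp_all add: card_image)
  moreover have "card (?A \<union> ?B) \<le> nat p"
  proof -
    have "?A \<union> ?B \<subseteq> {0..<p}" using prime_gt_0_int[OF p] by auto
    then have "card (?A \<union> ?B) \<le> card {0..<p}" by (intro card_mono) auto
    then show ?thesis by simp
  qed
  ultimately have "?A \<inter> ?B \<noteq> {}"
    using h h0 card_Un_disjoint[of ?A ?B] by auto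
  then have "\<exists>x\<in>{0..h}. \<exists>y\<in>{0..h}. x\<^sup>2 mod p = (- y\<^sup>2 - 1) mod p"
    by blast
  then obtain x y where xy: "x \<in> {0..h}" "y \<in> {0..h}" "x\<^sup>2 mod p = (- y\<^sup>2 - 1) mod p"
    by blast
  from xy(3) have "p dvd x\<^sup>2 + y\<^sup>2 + 1" unfolding mod_eq_dvd_iff by (simp add: algebra_simps)
  then show ?thesis using xy h by (intro exI[of _ x] exI[of _ y]) auto
qed

lemma sum_of_four_squares_prime:
  fixes p :: int
  assumes p: "prime p"
  shows "sum_of_four_squares p"
proof (cases "p = 2")
  case True
  have "(2::int) = 1\<^sup>2 + 1\<^sup>2 + 0\<^sup>2 + 0\<^sup>2" by simp
  then show ?thesis unfolding True sum_of_four_squares_def by blast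
next
  case False
  then have "odd p" using p prime_ge_2_int[OF p] by (intro prime_odd_int) auto
  then obtain x y where xy: "0 \<le> x" "2 * x < p" "0 \<le> y" "2 * y < p" "p dvd x\<^sup>2 + y\<^sup>2 + 1"
    using ex_two_squares_plus_one_multiple[OF p] by blast
  then obtain m where m: "x\<^sup>2 + y\<^sup>2 + 1 = m * p" by (auto simp: dvd_def mult.commute)
  have p2: "p \<ge> 2" using p by (rule prime_ge_2_int)
  have "4 * x\<^sup>2 + 4 * y\<^sup>2 + 4 < 4 * (p * p)"
  proof -
    have "2 * \<bar>x\<bar> \<le> p" "2 * \<bar>y\<bar> \<le> p" using xy by auto
    then have "4 * x\<^sup>2 \<le> p * p" "4 * y\<^sup>2 \<le> p * p"
      using square_le_of_centered by (auto simp: power2_eq_square)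
    moreover have "p * p \<ge> 2 * 2" using p2 by (intro mult_mono) auto
    ultimately show ?thesis by linarith
  qed
  then have "m * p < p * p" using m by linarith
  then have mp: "m < p" using p2 by simp
  have "0 < m * p" using m by (smt (verit) zero_le_power2)
  then have m0: "0 < m" using p2 by (simp add: zero_less_mult_iff)
  have "m * p = x\<^sup>2 + y\<^sup>2 + 1\<^sup>2 + 0\<^sup>2" using m by simp
  then have "sum_of_four_squares (m * p)" unfolding sum_of_four_squares_def by blast
  with m0 mp have "sum_of_four_squares (1 * p)"
  proof (induction "nat m" arbitrary: m rule: less_induct)
    case less
    show ?case
    proof (cases "m = 1")
      case True
      then show ?thesis using less.prems by simp
    next
      case False
      then obtain r where "0 < r" "r < m" "sum_of_four_squares (r * p)"
        using four_squares_descent[OF p, of m] less.prems by auto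
      then show ?thesis using less.hyps[of r] less.prems by auto
    qed
  qed
  then show ?thesis by simp
qed

theorem lagrange_four_squares: "sum_of_four_squares (int n)"
proof (induction n rule: prime_divisors_induct)
  case zero
  have "(0::int) = 0\<^sup>2 + 0\<^sup>2 + 0\<^sup>2 + 0\<^sup>2" by simp
  then show ?case unfolding sum_of_four_squares_def of_nat_0 by blast
next
  case (unit x)
  have "(1::int) = 1\<^sup>2 + 0\<^sup>2 + 0\<^sup>2 + 0\<^sup>2" by simp
  then have "sum_of_four_squares 1" unfolding sum_of_four_squares_def by blast
  then show ?case using unit by simp
next
  case (factor q x)
  then show ?case using sum_of_four_squares_mult[OF sum_of_four_squares_prime[of "int q"]] by simp
qed

lemma ex_four_squares_indexed: "\<exists>t. int m = (\<Sum>k\<in>{0..<4::nat}. (t k)\<^sup>2)"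
proof -
  obtain a b c d where "int m = a\<^sup>2 + b\<^sup>2 + c\<^sup>2 + d\<^sup>2"
    using lagrange_four_squares unfolding sum_of_four_squares_def by blast
  then have "int m = (\<Sum>k\<in>{0..<4::nat}. ([a, b, c, d] ! k)\<^sup>2)"
    by (simp add: eval_nat_numeral)
  then show ?thesis by (rule exI[of _ "\<lambda>k. [a, b, c, d] ! k"])
qed

section \<open>Integral symmetric forms and elementary base changes\<close>

text \<open>
  Forms are functions on pairs of indices, evaluated on a finite index set \<open>I\<close>. This keeps the indices
  fixed when a variable is eliminated: the set \<open>I\<close> shrinks and nothing is renumbered.
\<close>
definition bilin :: "nat set \<Rightarrow> (nat \<Rightarrow> nat \<Rightarrow> 'a) \<Rightarrow> (nat \<Rightarrow> 'a) \<Rightarrow> (nat \<Rightarrow> 'a) \<Rightarrow> 'a::comm_ring_1" where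
  "bilin I g x y = (\<Sum>a\<in>I. \<Sum>b\<in>I. g a b * x a * y b)"

definition sym_form :: "(nat \<Rightarrow> nat \<Rightarrow> 'a) \<Rightarrow> bool" where
  "sym_form g \<longleftrightarrow> (\<forall>a b. g a b = g b a)"

definition pos_def_on :: "nat set \<Rightarrow> (nat \<Rightarrow> nat \<Rightarrow> int) \<Rightarrow> bool" where
  "pos_def_on I g \<longleftrightarrow> (\<forall>x. (\<exists>a\<in>I. x a \<noteq> 0) \<longrightarrow> 0 < bilin I g x x)"

lemma bilin_cong:
  assumes "\<And>a b. a \<in> I \<Longrightarrow> b \<in> I \<Longrightarrow> g a b = h a b"
    and "\<And>a. a \<in> I \<Longrightarrow> x a = x' a" and "\<And>a. a \<in> I \<Longrightarrow> y a = y' a"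
  shows "bilin I g x y = bilin I h x' y'"
  unfolding bilin_def using assms by (intro sum.cong) auto

lemma bilin_insert:
  assumes "finite I" "m \<notin> I" "sym_form g"
  shows "bilin (insert m I) g x x = g m m * (x m)\<^sup>2 + 2 * x m * (\<Sum>a\<in>I. g m a * x a) + bilin I g x x"
proof -
  have "(\<Sum>a\<in>I. g a m * x a * x m) = x m * (\<Sum>a\<in>I. g m a * x a)"
    unfolding sum_distrib_left using assms(3) by (intro sum.cong) (auto simp: sym_form_def mult_ac)
  moreover have "(\<Sum>b\<in>I. g m b * x m * x b) = x m * (\<Sum>a\<in>I. g m a * x a)"
    unfolding sum_distrib_left by (intro sum.cong) (auto simp: mult_ac)
  ultimately show ?thesis
    using assms(1,2) unfolding bilin_def by (simp add: sum.distrib power2_eq_square algebra_simps)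
qed

lemma bilin_rank_one: "bilin I (\<lambda>a b. u a * v b) x y = (\<Sum>a\<in>I. u a * x a) * (\<Sum>b\<in>I. v b * y b)"
  unfolding bilin_def sum_product by (intro sum.cong refl) (simp add: mult_ac)

lemma bilin_add: "bilin I (\<lambda>a b. g a b + h a b) x y = bilin I g x y + bilin I h x y"
  unfolding bilin_def by (simp add: sum.distrib distrib_right)

lemma bilin_scale: "bilin I (\<lambda>a b. c * g a b) x y = c * bilin I g x y"
  unfolding bilin_def sum_distrib_left by (intro sum.cong refl) (simp add: mult_ac)

text \<open>
  The Gram matrix after the base change \<open>e\<^sub>j \<mapsto> e\<^sub>j + k e\<^sub>i\<close>. These base changes suffice for reduction,
  and unlike a general unimodular matrix they need no bookkeeping of an inverse.
\<close>
definition shear :: "nat \<Rightarrow> nat \<Rightarrow> int \<Rightarrow> (nat \<Rightarrow> nat \<Rightarrow> int) \<Rightarrow> nat \<Rightarrow> nat \<Rightarrow> int" where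
  "shear i j k g a b = g a b + (if a = j then k * g i b else 0) + (if b = j then k * g a i else 0)
     + (if a = j \<and> b = j then k * k * g i i else 0)"

inductive shear_equiv :: "nat set \<Rightarrow> (nat \<Rightarrow> nat \<Rightarrow> int) \<Rightarrow> (nat \<Rightarrow> nat \<Rightarrow> int) \<Rightarrow> bool" for I where
  unchanged: "shear_equiv I g g"
| sheared: "shear_equiv I g g' \<Longrightarrow> i \<in> I \<Longrightarrow> j \<in> I \<Longrightarrow> i \<noteq> j \<Longrightarrow> shear_equiv I g (shear i j k g')"

lemma shear_equiv_trans:
  assumes "shear_equiv I f g" "shear_equiv I g h"
  shows "shear_equiv I f h"
  using assms(2,1) by induction (auto intro: shear_equiv.intros)

lemma shear_equiv_mono:
  assumes "shear_equiv I f g" "I \<subseteq> J"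
  shows "shear_equiv J f g"
  using assms by induction (auto intro: shear_equiv.intros)

lemma sym_form_shear: "sym_form g \<Longrightarrow> sym_form (shear i j k g)"
  unfolding sym_form_def shear_def by auto

lemma shear_inverse: "i \<noteq> j \<Longrightarrow> shear i j (- k) (shear i j k g) = g"
  by (intro ext) (auto simp: shear_def algebra_simps)

lemma sum_update_shear:
  fixes f x :: "nat \<Rightarrow> int"
  assumes "finite I" "i \<in> I" "j \<in> I" "i \<noteq> j"
  shows "(\<Sum>a\<in>I. f a * (x(i := x i + k * x j)) a) = (\<Sum>a\<in>I. (f a + (if a = j then k * f i else 0)) * x a)"
proof -
  have "(\<Sum>a\<in>I. f a * (x(i := x i + k * x j)) a) = (\<Sum>a\<in>I. f a * x a + (if a = i then f i * (k * x j) else 0))"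
    by (intro sum.cong) (auto simp: algebra_simps)
  also have "\<dots> = (\<Sum>a\<in>I. f a * x a) + k * f i * x j"
    using assms by (simp add: sum.distrib)
  also have "\<dots> = (\<Sum>a\<in>I. f a * x a + (if a = j then k * f i * x j else 0))"
    using assms by (simp add: sum.distrib)
  also have "\<dots> = (\<Sum>a\<in>I. (f a + (if a = j then k * f i else 0)) * x a)"
    by (intro sum.cong) (auto simp: algebra_simps)
  finally show ?thesis .
qed

text \<open>
  A vector with coordinates \<open>x\<close> in the new basis has \<open>x\<^sub>i + k x\<^sub>j\<close> as its \<open>i\<close>-th coordinate in the old one.
\<close>
lemma bilin_shear:
  assumes I: "finite I" "i \<in> I" "j \<in> I" "i \<noteq> j"
  shows "bilin I (shear i j k g) x y = bilin I g (x(i := x i + k * x j)) (y(i := y i + k * y j))"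
proof -
  let ?x = "x(i := x i + k * x j)" and ?y = "y(i := y i + k * y j)"
  have "bilin I g ?x ?y = (\<Sum>a\<in>I. (\<Sum>b\<in>I. g a b * ?y b) * ?x a)"
    unfolding bilin_def sum_distrib_right by (simp only: mult_ac)
  also have "\<dots> = (\<Sum>a\<in>I. (\<Sum>b\<in>I. (g a b + (if b = j then k * g a i else 0)) * y b) * ?x a)"
    by (simp only: sum_update_shear[OF I])
  also have "\<dots> = (\<Sum>a\<in>I. ((\<Sum>b\<in>I. (g a b + (if b = j then k * g a i else 0)) * y b)
       + (if a = j then k * (\<Sum>b\<in>I. (g i b + (if b = j then k * g i i else 0)) * y b) else 0)) * x a)"
    by (rule sum_update_shear[OF I])
  also have "\<dots> = bilin I (shear i j k g) x y"
    unfolding bilin_def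
    by (intro sum.cong refl)
      (auto simp: shear_def sum_distrib_left sum_distrib_right sum.distrib[symmetric] algebra_simps intro!: sum.cong)
  finally show ?thesis ..
qed

lemma pos_def_on_shear:
  assumes "finite I" "i \<in> I" "j \<in> I" "i \<noteq> j" "pos_def_on I g"
  shows "pos_def_on I (shear i j k g)"
  unfolding pos_def_on_def
proof (intro allI impI)
  fix x :: "nat \<Rightarrow> int" assume x: "\<exists>a\<in>I. x a \<noteq> 0"
  have "\<exists>a\<in>I. (x(i := x i + k * x j)) a \<noteq> 0"
  proof (rule ccontr)
    assume "\<not> ?thesis"
    then have *: "(x(i := x i + k * x j)) a = 0" if "a \<in> I" for a using that by blast
    from *[OF assms(2)] *[OF assms(3)] assms(4) have "x i = 0" by auto
    moreover have "x a = 0" if "a \<in> I" "a \<noteq> i" for a using *[OF that(1)] that(2) by simp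
    ultimately show False using x by metis
  qed
  then show "0 < bilin I (shear i j k g) x x"
    using assms(5) unfolding bilin_shear[OF assms(1-4)] pos_def_on_def by blast
qed

lemma shear_equiv_preserves:
  assumes "shear_equiv I g h" "finite I"
  shows "sym_form g \<Longrightarrow> sym_form h" "pos_def_on I g \<Longrightarrow> pos_def_on I h"
  using assms by (induction, auto intro: sym_form_shear pos_def_on_shear)

text \<open>
  The form that remains after completing the square in the variable \<open>m\<close>, multiplied by \<open>g m m\<close> so
  that it stays integral.
\<close>
definition schur :: "nat \<Rightarrow> (nat \<Rightarrow> nat \<Rightarrow> 'a) \<Rightarrow> nat \<Rightarrow> nat \<Rightarrow> 'a::comm_ring_1" where
  "schur m g a b = g m m * g a b - g a m * g m b"

lemma schur_shear: "m \<noteq> i \<Longrightarrow> m \<noteq> j \<Longrightarrow> schur m (shear i j k g) = shear i j k (schur m g)"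
  by (intro ext) (simp add: schur_def shear_def algebra_simps)

text \<open>
  Changing the complement of \<open>e\<^sub>m\<close> does not change the projection along \<open>e\<^sub>m\<close>. Hence the pivot row can
  be size-reduced after the remaining variables have been reduced.
\<close>
lemma schur_shear_pivot: "m \<noteq> j \<Longrightarrow> schur m (shear m j k g) = schur m g"
  by (intro ext) (simp add: schur_def shear_def algebra_simps)

lemma sym_form_schur: "sym_form g \<Longrightarrow> sym_form (schur m g)"
  unfolding sym_form_def schur_def by (simp add: mult.commute)

text \<open>
  Base changes of the remaining variables lift to the whole form with the same pivot, which is what
  an induction on the number of variables requires.
\<close>
lemma shear_equiv_schur:
  assumes "shear_equiv I f h" "f = schur m g" "m \<notin> I"
  shows "\<exists>g'. shear_equiv I g g' \<and> schur m g' = h \<and> g' m m = g m m"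
  using assms
proof (induction)
  case (unchanged f)
  then show ?case by (metis shear_equiv.unchanged)
next
  case (sheared f f' i j k)
  then obtain g' where g': "shear_equiv I g g'" "schur m g' = f'" "g' m m = g m m" by blast
  have m: "m \<noteq> i" "m \<noteq> j" using sheared by auto
  have "shear_equiv I g (shear i j k g')" using g' sheared by (auto intro: shear_equiv.intros)
  moreover have "shear i j k g' m m = g m m" using m g' by (simp add: shear_def)
  ultimately show ?case using g' m by (metis schur_shear)
qed

lemma schur_bilin:
  assumes "finite I" "m \<notin> I" "sym_form g"
  shows "g m m * bilin (insert m I) g x x = (g m m * x m + (\<Sum>a\<in>I. g m a * x a))\<^sup>2 + bilin I (schur m g) x x"
proof -
  have "schur m g = (\<lambda>a b. g m m * g a b + (-1) * (g m a * g m b))"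
    using assms(3) by (intro ext) (simp add: schur_def sym_form_def)
  then have "bilin I (schur m g) x x = g m m * bilin I g x x - (\<Sum>a\<in>I. g m a * x a)\<^sup>2"
    by (simp only: bilin_add bilin_scale bilin_rank_one) (simp add: power2_eq_square)
  then show ?thesis
    unfolding bilin_insert[OF assms] by (simp add: power2_eq_square algebra_simps)
qed

lemma pos_def_on_diag:
  assumes "pos_def_on I g" "finite I" "m \<in> I"
  shows "0 < g m m"
proof -
  have "0 < bilin I g (\<lambda>a. if a = m then 1 else 0) (\<lambda>a. if a = m then 1 else 0)"
    using assms unfolding pos_def_on_def by auto
  also have "\<dots> = (\<Sum>a\<in>I. if a = m then (\<Sum>b\<in>I. if b = m then g a b else 0) else 0)"
    unfolding bilin_def by (auto intro!: sum.cong)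
  also have "\<dots> = g m m" using assms by simp
  finally show ?thesis .
qed

text \<open>
  With \<open>d = g m m\<close>, the integral vector \<open>y\<close> that equals \<open>d x\<close> off \<open>m\<close> and whose entry at \<open>m\<close> annihilates
  the completed square has \<open>g(y, y) = d \<cdot> schur(x, x)\<close>.
\<close>
lemma pos_def_on_schur:
  assumes "finite I" "m \<notin> I" "sym_form g" "pos_def_on (insert m I) g"
  shows "pos_def_on I (schur m g)"
  unfolding pos_def_on_def
proof (intro allI impI)
  fix x :: "nat \<Rightarrow> int" assume x: "\<exists>a\<in>I. x a \<noteq> 0"
  have d: "0 < g m m" using pos_def_on_diag[OF assms(4)] assms(1) by simp
  define y where "y a = (if a = m then - (\<Sum>a\<in>I. g m a * x a) else g m m * x a)" for a
  have yI: "a \<in> I \<Longrightarrow> y a = g m m * x a" for a using assms(2) by (auto simp: y_def)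
  have "(\<Sum>a\<in>I. g m a * y a) = g m m * (\<Sum>a\<in>I. g m a * x a)"
    unfolding sum_distrib_left by (intro sum.cong) (auto simp: yI)
  moreover have "bilin I (schur m g) y y = g m m * (g m m * bilin I (schur m g) x x)"
    unfolding bilin_def sum_distrib_left by (intro sum.cong) (auto simp: yI)
  ultimately have "g m m * bilin (insert m I) g y y = g m m * (g m m * bilin I (schur m g) x x)"
    unfolding schur_bilin[OF assms(1-3)] by (simp add: y_def)
  then have "bilin (insert m I) g y y = g m m * bilin I (schur m g) x x" using d by simp
  moreover have "0 < bilin (insert m I) g y y"
    using assms(4) x d yI unfolding pos_def_on_def by (metis insertI2 less_irrefl mult_eq_0_iff)
  ultimately show "0 < bilin I (schur m g) x x" using d by (simp add: zero_less_mult_iff)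
qed

section \<open>Reduction of positive definite forms\<close>

text \<open>The diagonal entries in an equivalence class are positive integers, so one of them is least.\<close>
lemma ex_minimal_pivot:
  assumes "pos_def_on I g" "finite I" "m \<in> I"
  shows "\<exists>g'. shear_equiv I g g' \<and> (\<forall>h. shear_equiv I g' h \<longrightarrow> g' m m \<le> h m m)"
proof -
  obtain g' where g': "shear_equiv I g g'" "\<And>h. shear_equiv I g h \<Longrightarrow> nat (g' m m) \<le> nat (h m m)"
    using ex_has_least_nat[of "shear_equiv I g" g "\<lambda>h. nat (h m m)"] shear_equiv.unchanged by blast
  have "g' m m \<le> h m m" if "shear_equiv I g' h" for h
  proof -
    have h: "shear_equiv I g h" using shear_equiv_trans[OF g'(1) that] .
    have "0 < h m m" using pos_def_on_diag shear_equiv_preserves(2)[OF h] assms by blast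
    then show ?thesis using g'(2)[OF h] by linarith
  qed
  with g'(1) show ?thesis by blast
qed

text \<open>
  Three shears take \<open>(e\<^sub>m, e\<^sub>i)\<close> to \<open>(e\<^sub>i, - e\<^sub>m)\<close>. So a minimal pivot is at most every other diagonal
  entry.
\<close>
lemma shear_equiv_swap:
  assumes "m \<in> I" "i \<in> I" "m \<noteq> i" "sym_form g"
  shows "\<exists>h. shear_equiv I g h \<and> h m m = g i i"
proof (intro exI conjI)
  let ?h = "shear i m 1 (shear m i (-1) (shear i m 1 g))"
  show "shear_equiv I g ?h"
    using assms by (intro shear_equiv.intros) auto
  show "?h m m = g i i"
    using assms(3,4) by (auto simp: shear_def sym_form_def)
qed

lemma ex_size_reduced:
  assumes "finite J" "m \<notin> J" "0 < g m m"
  shows "\<exists>g'. shear_equiv (insert m J) g g' \<and> schur m g' = schur m g \<and> g' m m = g m m \<and>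
           (\<forall>j\<in>J. 2 * \<bar>g' m j\<bar> \<le> g m m)"
  using assms
proof (induction J rule: finite_induct)
  case empty
  then show ?case using shear_equiv.unchanged by blast
next
  case (insert j J)
  then obtain g1 where g1: "shear_equiv (insert m J) g g1" "schur m g1 = schur m g" "g1 m m = g m m"
      "\<forall>j\<in>J. 2 * \<bar>g1 m j\<bar> \<le> g m m"
    by auto
  obtain r k where rk: "g1 m j = r + g m m * k" "2 * \<bar>r\<bar> \<le> g m m"
    using ex_centered_residue[OF insert.prems(2)] by blast
  let ?g = "shear m j (- k) g1"
  have mj: "m \<noteq> j" using insert.prems by auto
  have "shear_equiv (insert m (insert j J)) g g1"
    by (rule shear_equiv_mono[OF g1(1)]) auto
  then have "shear_equiv (insert m (insert j J)) g ?g"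
    using mj by (intro shear_equiv.sheared) auto
  moreover have "schur m ?g = schur m g" using schur_shear_pivot[OF mj] g1 by simp
  moreover have "?g m m = g m m" using mj g1 by (simp add: shear_def)
  moreover have "2 * \<bar>?g m a\<bar> \<le> g m m" if "a \<in> insert j J" for a
    using that mj g1 rk by (cases "a = j") (auto simp: shear_def algebra_simps)
  ultimately show ?case by blast
qed

lemma square_sum_le:
  fixes f :: "'a \<Rightarrow> real"
  assumes "finite I"
  shows "(\<Sum>i\<in>I. f i)\<^sup>2 \<le> real (card I) * (\<Sum>i\<in>I. (f i)\<^sup>2)"
proof -
  have "0 \<le> (\<Sum>i\<in>I. \<Sum>j\<in>I. (f i - f j)\<^sup>2)" by (intro sum_nonneg) auto
  also have "\<dots> = (\<Sum>i\<in>I. \<Sum>j\<in>I. (f i)\<^sup>2 + (f j)\<^sup>2 - 2 * (f i * f j))"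
    by (simp add: power2_eq_square algebra_simps)
  also have "\<dots> = 2 * (real (card I) * (\<Sum>i\<in>I. (f i)\<^sup>2)) - 2 * (\<Sum>i\<in>I. f i)\<^sup>2"
    unfolding power2_eq_square[of "sum f I"] sum_product
    by (simp add: sum.distrib sum_subtractf sum_distrib_left[symmetric])
  finally show ?thesis by simp
qed

text \<open>
  The form is comparable with the diagonal form of the increasing weights \<open>h\<close>: \<open>c\<close> times the latter is a
  lower bound, and \<open>C\<close> controls the entries. The weights are kept apart from the diagonal of \<open>g\<close>
  so that the notion, with worse constants, is stable under small perturbations of \<open>g\<close>.
\<close>
definition reduced_form :: "nat \<Rightarrow> nat \<Rightarrow> real \<Rightarrow> real \<Rightarrow> (nat \<Rightarrow> nat \<Rightarrow> real) \<Rightarrow> bool" where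
  "reduced_form m n c C g \<longleftrightarrow> sym_form g \<and> (\<exists>h.
     (\<forall>i\<in>{m..<n}. 0 < h i) \<and>
     (\<forall>i\<in>{m..<n}. \<forall>j\<in>{m..<n}. i \<le> j \<longrightarrow> h i \<le> h j \<and> \<bar>g i j\<bar> \<le> C * h i) \<and>
     (\<forall>x. c * (\<Sum>i\<in>{m..<n}. h i * (x i)\<^sup>2) \<le> bilin {m..<n} g x x))"

text \<open>
  Hermite--Korkine--Zolotarev reduction, by induction on the number of variables. Choose the pivot \<open>d\<close>
  minimal in the equivalence class, reduce the Schur complement by induction, and size-reduce the
  pivot row. Minimality of \<open>d\<close> gives \<open>g(m+1, m+1) \<ge> d\<close>, and with the row bound \<open>d/2\<close> the next diagonal entry
  of the projected form is at least \<open>3d/4\<close>. Thus the weights can be chosen increasing, with constants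
  that depend on the number of variables only.
\<close>
theorem ex_reduced_form:
  assumes "m \<le> n"
  shows "\<exists>c>0. \<exists>C>0. \<forall>g. sym_form g \<longrightarrow> pos_def_on {m..<n} g \<longrightarrow>
    (\<exists>g'. shear_equiv {m..<n} g g' \<and> reduced_form m n c C (\<lambda>i j. real_of_int (g' i j)))"
  using assms
proof (induction rule: inc_induct)
  case base
  have base_form: "reduced_form n n 1 1 (\<lambda>i j. real_of_int (g i j))" if "sym_form g" for g
    using that unfolding reduced_form_def sym_form_def bilin_def by auto
  show ?case
  proof (intro exI[of _ "1::real"] conjI allI impI)
    fix g :: "nat \<Rightarrow> nat \<Rightarrow> int"
    assume "sym_form g"
    then show "\<exists>g'. shear_equiv {n..<n} g g' \<and> reduced_form n n 1 1 (\<lambda>i j. real_of_int (g' i j))"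
      by (intro exI[of _ g] conjI shear_equiv.unchanged base_form)
  qed simp_all
next
  case (step m)
  define I where "I = {Suc m..<n}"
  have I: "finite I" "m \<notin> I" "{m..<n} = insert m I" "\<And>i. i \<in> I \<Longrightarrow> m < i"
    using step.hyps unfolding I_def by auto
  from step.IH obtain c' C' where c': "0 < c'" and C': "0 < C'" and
    IH0: "\<forall>g. sym_form g \<longrightarrow> pos_def_on {Suc m..<n} g \<longrightarrow>
      (\<exists>g'. shear_equiv {Suc m..<n} g g' \<and> reduced_form (Suc m) n c' C' (\<lambda>i j. real_of_int (g' i j)))"
    by blast
  have IH: "\<exists>g'. shear_equiv I g g' \<and> reduced_form (Suc m) n c' C' (\<lambda>i j. real_of_int (g' i j))"
    if "sym_form g" "pos_def_on I g" for g
    using IH0 that unfolding I_def by simp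
  define N where "N = real (card I)"
  define \<kappa> where "\<kappa> = 3 / (2 * C') + (N / 2 + 1) / c'"
  have p: "0 < 3 / (2 * C')" "0 < (N / 2 + 1) / c'"
    using c' C' unfolding N_def by (auto intro!: divide_pos_pos add_nonneg_pos)
  have "N / 2 + 1 = (N / 2 + 1) / c' * c'" using c' by simp
  also have "\<dots> \<le> \<kappa> * c'" using p c' unfolding \<kappa>_def by (intro mult_right_mono) linarith+
  finally have \<kappa>: "0 < \<kappa>" "3 / (2 * C') \<le> \<kappa>" "N / 2 + 1 \<le> \<kappa> * c'"
    using p unfolding \<kappa>_def by linarith+
  have "\<exists>g'. shear_equiv {m..<n} g g' \<and> reduced_form m n (1 / \<kappa>) (4 * C' / 3) (\<lambda>i j. real_of_int (g' i j))"
    if g: "sym_form g" "pos_def_on {m..<n} g" for g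
  proof -
    obtain g1 where g1: "shear_equiv (insert m I) g g1"
        "\<And>h. shear_equiv (insert m I) g1 h \<Longrightarrow> g1 m m \<le> h m m"
      using ex_minimal_pivot[OF g(2)[unfolded I(3)]] I(1) by blast
    have g1': "sym_form g1" "pos_def_on (insert m I) g1"
      using shear_equiv_preserves[OF g1(1)] g(1) g(2)[unfolded I(3)] I(1) by simp_all
    obtain H where H: "shear_equiv I (schur m g1) H"
        "reduced_form (Suc m) n c' C' (\<lambda>i j. real_of_int (H i j))"
      using IH[of "schur m g1"] sym_form_schur[OF g1'(1)] pos_def_on_schur[OF I(1,2) g1'] by blast
    obtain g2 where g2: "shear_equiv I g1 g2" "schur m g2 = H" "g2 m m = g1 m m"
      using shear_equiv_schur[OF H(1) refl I(2)] by blast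
    have pivot: "0 < g1 m m" using pos_def_on_diag[OF g1'(2)] I(1) by simp
    obtain g3 where g3: "shear_equiv (insert m I) g2 g3" "schur m g3 = H" "g3 m m = g1 m m"
        "\<forall>j\<in>I. 2 * \<bar>g3 m j\<bar> \<le> g1 m m"
      using ex_size_reduced[OF I(1,2), of g2] pivot unfolding g2(2,3) by blast
    have g13: "shear_equiv (insert m I) g1 g3"
      using shear_equiv_trans[OF shear_equiv_mono[OF g2(1)] g3(1)] by blast
    have g3': "sym_form g3" using shear_equiv_preserves(1)[OF g13] g1'(1) I(1) by simp
    define G where "G i j = real_of_int (g3 i j)" for i j
    have symG: "sym_form G" using g3' unfolding G_def sym_form_def by simp
    define d where "d = G m m"
    have d: "0 < d" using pivot g3 unfolding d_def G_def by simp
    have HG: "real_of_int (H i j) = schur m G i j" for i j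
      unfolding g3(2)[symmetric] schur_def G_def by simp
    have off: "\<bar>G m j\<bar> \<le> d / 2" if "j \<in> I" for j
      using g3(4) that g3(3) unfolding G_def d_def by fastforce
    from H(2) obtain h' where h': "\<forall>i\<in>I. 0 < h' i"
        "\<forall>i\<in>I. \<forall>j\<in>I. i \<le> j \<longrightarrow> h' i \<le> h' j \<and> \<bar>schur m G i j\<bar> \<le> C' * h' i"
        "\<And>x. c' * (\<Sum>i\<in>I. h' i * (x i)\<^sup>2) \<le> bilin I (schur m G) x x"
      unfolding reduced_form_def HG I_def[symmetric] by blast
    \<comment> \<open>\<open>h m\<close> is just small enough for \<open>h m \<le> h (Suc m)\<close>;
      the other weights undo the factor \<open>d\<close> in the Schur complement\<close>
    define h where "h i = (if i = m then 3 * d / (4 * C') else h' i / d)" for i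
    have hI: "h i = h' i / d" if "i \<in> I" for i using that I(2) unfolding h_def by auto
    have hm: "h m = 3 * d / (4 * C')" unfolding h_def by simp
    have hmpos: "0 < h m" unfolding hm using d C' by simp
    have hm_le: "h m \<le> h i" if i: "i \<in> I" for i
    proof -
      have s: "Suc m \<in> I" using i unfolding I_def by auto
      obtain q where "shear_equiv (insert m I) g3 q" "q m m = g3 (Suc m) (Suc m)"
        using shear_equiv_swap[of m "insert m I" "Suc m" g3] s g3' by auto
      then have "g1 m m \<le> g3 (Suc m) (Suc m)"
        using g1(2) shear_equiv_trans[OF g13] by metis
      then have "d \<le> G (Suc m) (Suc m)" unfolding d_def G_def using g3(3) by simp
      then have "d * d \<le> d * G (Suc m) (Suc m)" using d by simp
      moreover have "G (Suc m) m * G m (Suc m) \<le> d / 2 * (d / 2)"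
      proof -
        have "\<bar>G m (Suc m)\<bar> * \<bar>G m (Suc m)\<bar> \<le> d / 2 * (d / 2)"
          using off[OF s] d by (intro mult_mono) auto
        then show ?thesis using symG unfolding sym_form_def by (metis abs_mult_self_eq)
      qed
      moreover have "schur m G (Suc m) (Suc m) \<le> C' * h' (Suc m)"
        using h'(2) s by fastforce
      ultimately have "3 / 4 * (d * d) \<le> C' * h' (Suc m)"
        unfolding schur_def d_def[symmetric] by simp
      moreover have "h' (Suc m) \<le> h' i" using h'(2) s i unfolding I_def by auto
      ultimately have "3 / 4 * (d * d) \<le> C' * h' i"
        using C' by (smt (verit) mult_left_mono)
      then show ?thesis unfolding hm hI[OF i] using d C' by (simp add: field_simps)
    qed
    have lower: "1 / \<kappa> * (\<Sum>i\<in>{m..<n}. h i * (x i)\<^sup>2) \<le> bilin {m..<n} G x x" for x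
    proof -
      define T where "T = (\<Sum>a\<in>I. G m a * x a)"
      define A where "A = (d * x m + T)\<^sup>2"
      define S where "S = (\<Sum>i\<in>I. h i * (x i)\<^sup>2)"
      have S0: "0 \<le> S" unfolding S_def using hm_le hmpos
        by (intro sum_nonneg) (auto intro!: mult_nonneg_nonneg intro: order_trans less_imp_le)
      have N0: "0 \<le> N" unfolding N_def by simp
      have "c' * (d * S) \<le> bilin I (schur m G) x x"
      proof -
        have "d * S = (\<Sum>i\<in>I. h' i * (x i)\<^sup>2)"
          unfolding S_def sum_distrib_left using d by (intro sum.cong) (auto simp: hI)
        then show ?thesis using h'(3) by simp
      qed
      then have G: "A + c' * d * S \<le> d * bilin {m..<n} G x x"
        unfolding I(3) d_def schur_bilin[OF I(1,2) symG] A_def T_def by simp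
      have "T\<^sup>2 \<le> N * (\<Sum>a\<in>I. (G m a * x a)\<^sup>2)"
        unfolding T_def N_def by (rule square_sum_le[OF I(1)])
      also have "\<dots> \<le> N * (\<Sum>a\<in>I. d\<^sup>2 / 4 * (x a)\<^sup>2)"
      proof (intro mult_left_mono sum_mono N0)
        fix a assume "a \<in> I"
        then have "\<bar>G m a\<bar>\<^sup>2 \<le> (d / 2)\<^sup>2" using off by (intro power_mono) auto
        then have "(G m a)\<^sup>2 \<le> d\<^sup>2 / 4" by (simp add: power_divide)
        then show "(G m a * x a)\<^sup>2 \<le> d\<^sup>2 / 4 * (x a)\<^sup>2"
          unfolding power_mult_distrib by (intro mult_right_mono) auto
      qed
      finally have "h m * T\<^sup>2 \<le> h m * (N * (\<Sum>a\<in>I. d\<^sup>2 / 4 * (x a)\<^sup>2))"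
        using hmpos by simp
      also have "\<dots> = N * d\<^sup>2 / 4 * (\<Sum>a\<in>I. h m * (x a)\<^sup>2)"
        by (simp add: sum_distrib_left mult_ac)
      also have "\<dots> \<le> N * d\<^sup>2 / 4 * S"
        unfolding S_def using hm_le N0 by (intro mult_left_mono sum_mono mult_right_mono) auto
      finally have T: "h m * T\<^sup>2 \<le> N * d\<^sup>2 / 4 * S" .
      \<comment> \<open>as \<open>T\<close> is bounded in terms of \<open>S\<close>, the square \<open>A\<close> controls \<open>x m\<close> up to a multiple of \<open>S\<close>\<close>
      have "(d * x m)\<^sup>2 \<le> 2 * A + 2 * T\<^sup>2"
        using zero_le_power2[of "d * x m + 2 * T"] unfolding A_def by (simp add: power2_eq_square algebra_simps)
      then have "h m * (d * x m)\<^sup>2 \<le> h m * (2 * A + 2 * T\<^sup>2)" using hmpos by simp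
      also have "\<dots> \<le> 2 * h m * A + N * d\<^sup>2 / 2 * S" using T by (simp add: algebra_simps)
      finally have "d\<^sup>2 * (h m * (x m)\<^sup>2 + S) \<le> 2 * h m * A + (N / 2 + 1) * d\<^sup>2 * S"
        by (simp add: power_mult_distrib algebra_simps)
      also have "2 * h m * A = d * (3 / (2 * C')) * A" unfolding hm by simp
      also have "d * (3 / (2 * C')) * A \<le> d * \<kappa> * A"
        using \<kappa> d unfolding A_def by (intro mult_right_mono mult_left_mono) auto
      also have "(N / 2 + 1) * d\<^sup>2 * S \<le> \<kappa> * c' * d\<^sup>2 * S"
        using \<kappa> S0 by (intro mult_right_mono) auto
      also have "d * \<kappa> * A + \<kappa> * c' * d\<^sup>2 * S = d * \<kappa> * (A + c' * d * S)"
        by (simp add: power2_eq_square algebra_simps)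
      also have "\<dots> \<le> d * \<kappa> * (d * bilin {m..<n} G x x)"
        using G d \<kappa> by (intro mult_left_mono) auto
      finally have "d\<^sup>2 * (h m * (x m)\<^sup>2 + S) \<le> d\<^sup>2 * (\<kappa> * bilin {m..<n} G x x)"
        by (simp add: power2_eq_square mult_ac)
      then have "h m * (x m)\<^sup>2 + S \<le> \<kappa> * bilin {m..<n} G x x"
        using d by simp
      moreover have "(\<Sum>i\<in>{m..<n}. h i * (x i)\<^sup>2) = h m * (x m)\<^sup>2 + S"
        unfolding I(3) S_def using I by simp
      ultimately show ?thesis using \<kappa>(1) by (simp add: field_simps)
    qed
    have entries: "h i \<le> h j \<and> \<bar>G i j\<bar> \<le> 4 * C' / 3 * h i" if ij: "i \<in> {m..<n}" "j \<in> {m..<n}" "i \<le> j" for i j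
    proof (cases "i = m")
      case True
      have "4 * C' / 3 * h m = d" unfolding hm using C' by simp
      moreover have "\<bar>G m j\<bar> \<le> d"
      proof (cases "j = m")
        case True
        then show ?thesis using d unfolding d_def by simp
      next
        case False
        then show ?thesis using off[of j] ij d I by auto
      qed
      ultimately show ?thesis using True hm_le[of j] ij I by (cases "j = m") auto
    next
      case False
      then have iI: "i \<in> I" and jI: "j \<in> I" using ij unfolding I_def by auto
      have "h i \<le> h j" using h'(2) iI jI ij(3) d unfolding hI[OF iI] hI[OF jI] by (simp add: divide_right_mono)
      moreover have "\<bar>G i j\<bar> \<le> 4 * C' / 3 * h i"
      proof -
        have "\<bar>G i m\<bar> * \<bar>G m j\<bar> \<le> d / 2 * (d / 2)"
          using off[OF iI] off[OF jI] d symG unfolding sym_form_def by (intro mult_mono) auto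
        moreover have "\<bar>schur m G i j\<bar> \<le> C' * h' i" using h'(2) iI jI ij by blast
        moreover have "d * G i j = schur m G i j + G i m * G m j" unfolding schur_def d_def by simp
        then have "d * \<bar>G i j\<bar> \<le> \<bar>schur m G i j\<bar> + \<bar>G i m\<bar> * \<bar>G m j\<bar>"
          using d by (metis abs_mult abs_of_pos abs_triangle_ineq)
        ultimately have "d * \<bar>G i j\<bar> \<le> C' * h' i + d / 2 * (d / 2)" by linarith
        also have "h' i = d * h i" using hI[OF iI] d by simp
        also have "C' * (d * h i) + d / 2 * (d / 2) = d * (C' * h i + d / 4)" by (simp add: algebra_simps)
        also have "d / 4 = C' / 3 * h m" unfolding hm using C' by simp
        finally have "\<bar>G i j\<bar> \<le> C' * h i + C' / 3 * h m" using d by simp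
        also have "\<dots> \<le> C' * h i + C' / 3 * h i" using hm_le[OF iI] C' by simp
        finally show ?thesis by simp
      qed
      ultimately show ?thesis by blast
    qed
    have "0 < h i" if "i \<in> {m..<n}" for i
      using that hmpos hm_le[of i] unfolding I(3) by fastforce
    then have "reduced_form m n (1 / \<kappa>) (4 * C' / 3) G"
      unfolding reduced_form_def using symG entries lower by blast
    then show ?thesis
      using shear_equiv_trans[OF g1(1) g13] unfolding I(3) G_def by blast
  qed
  moreover have "0 < 1 / \<kappa>" "0 < 4 * C' / 3" using \<kappa> C' by auto
  ultimately show ?case by (intro exI[of _ "1 / \<kappa>"] exI[of _ "4 * C' / 3"] conjI allI impI)
qed

section \<open>Reduced forms in a finitely generated cone\<close>

definition int_box :: "nat \<Rightarrow> nat \<Rightarrow> nat \<Rightarrow> (nat \<Rightarrow> int) set" where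
  "int_box m n K = {v. (\<forall>i\<in>{m..<n}. \<bar>v i\<bar> \<le> int K) \<and> (\<forall>i. i \<notin> {m..<n} \<longrightarrow> v i = 0)}"

lemma finite_int_box: "finite (int_box m n K)"
proof -
  have "int_box m n K \<subseteq> {v. \<forall>i. (i \<in> {m..<n} \<longrightarrow> v i \<in> {- int K..int K}) \<and> (i \<notin> {m..<n} \<longrightarrow> v i = 0)}"
    unfolding int_box_def by (auto simp: abs_le_iff) (metis atLeastLessThan_iff minus_le_iff)
  then show ?thesis
    by (rule finite_subset) (intro finite_set_of_finite_funs; simp)
qed

text \<open>
  The cone spanned by the forms \<open>v v\<^sup>T\<close> with \<open>v\<close> an integral vector of bounded entries, up to values at
  indices outside the range.
\<close>
definition rank_one_cone :: "nat \<Rightarrow> nat \<Rightarrow> nat \<Rightarrow> (nat \<Rightarrow> nat \<Rightarrow> real) set" where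
  "rank_one_cone m n K = {g. \<exists>l. (\<forall>v. 0 \<le> l v) \<and> (\<forall>i\<in>{m..<n}. \<forall>j\<in>{m..<n}.
     g i j = (\<Sum>v\<in>int_box m n K. l v * real_of_int (v i) * real_of_int (v j)))}"

lemma rank_one_coneI:
  assumes "\<And>v. 0 \<le> l v"
    and "\<And>i j. i \<in> {m..<n} \<Longrightarrow> j \<in> {m..<n} \<Longrightarrow>
      g i j = (\<Sum>v\<in>int_box m n K. l v * real_of_int (v i) * real_of_int (v j))"
  shows "g \<in> rank_one_cone m n K"
  unfolding rank_one_cone_def using assms by blast

lemma rank_one_cone_cong:
  assumes "f \<in> rank_one_cone m n K" "\<And>i j. i \<in> {m..<n} \<Longrightarrow> j \<in> {m..<n} \<Longrightarrow> g i j = f i j"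
  shows "g \<in> rank_one_cone m n K"
  using assms unfolding rank_one_cone_def by auto

lemma rank_one_cone_zero: "(\<lambda>i j. 0) \<in> rank_one_cone m n K"
  by (rule rank_one_coneI[of "\<lambda>v. 0"]) auto

lemma rank_one_cone_add:
  assumes "f \<in> rank_one_cone m n K" "g \<in> rank_one_cone m n K"
  shows "(\<lambda>i j. f i j + g i j) \<in> rank_one_cone m n K"
proof -
  obtain l where l: "\<forall>v. 0 \<le> l v" "\<forall>i\<in>{m..<n}. \<forall>j\<in>{m..<n}.
      f i j = (\<Sum>v\<in>int_box m n K. l v * real_of_int (v i) * real_of_int (v j))"
    using assms(1) unfolding rank_one_cone_def by blast
  obtain l' where l': "\<forall>v. 0 \<le> l' v" "\<forall>i\<in>{m..<n}. \<forall>j\<in>{m..<n}.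
      g i j = (\<Sum>v\<in>int_box m n K. l' v * real_of_int (v i) * real_of_int (v j))"
    using assms(2) unfolding rank_one_cone_def by blast
  show ?thesis
    by (rule rank_one_coneI[of "\<lambda>v. l v + l' v"]) (simp_all add: l l' distrib_right sum.distrib)
qed

lemma rank_one_cone_scale:
  assumes "f \<in> rank_one_cone m n K" "0 \<le> c"
  shows "(\<lambda>i j. c * f i j) \<in> rank_one_cone m n K"
proof -
  obtain l where l: "\<forall>v. 0 \<le> l v" "\<forall>i\<in>{m..<n}. \<forall>j\<in>{m..<n}.
      f i j = (\<Sum>v\<in>int_box m n K. l v * real_of_int (v i) * real_of_int (v j))"
    using assms(1) unfolding rank_one_cone_def by blast
  show ?thesis
    by (rule rank_one_coneI[of "\<lambda>v. c * l v"]) (simp_all add: l assms sum_distrib_left mult.assoc)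
qed

lemma rank_one_cone_sum:
  assumes "finite J" "\<And>k. k \<in> J \<Longrightarrow> f k \<in> rank_one_cone m n K"
  shows "(\<lambda>i j. \<Sum>k\<in>J. f k i j) \<in> rank_one_cone m n K"
  using assms
proof (induction J rule: finite_induct)
  case empty
  then show ?case by (simp add: rank_one_cone_zero)
next
  case (insert k J)
  then show ?case using rank_one_cone_add[of "f k" m n K "\<lambda>i j. \<Sum>k\<in>J. f k i j"] by simp
qed

lemma rank_one_cone_generator:
  assumes "v \<in> int_box m n K"
  shows "(\<lambda>i j. real_of_int (v i) * real_of_int (v j)) \<in> rank_one_cone m n K"
proof (rule rank_one_coneI[of "\<lambda>w. if w = v then 1 else 0"])
  fix i j
  have "(\<Sum>w\<in>int_box m n K. (if w = v then 1 else 0) * real_of_int (w i) * real_of_int (w j)) =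
        (\<Sum>w\<in>int_box m n K. if w = v then real_of_int (w i) * real_of_int (w j) else 0)"
    by (intro sum.cong) auto
  also have "\<dots> = real_of_int (v i) * real_of_int (v j)"
    using assms finite_int_box by simp
  finally show "real_of_int (v i) * real_of_int (v j) =
    (\<Sum>w\<in>int_box m n K. (if w = v then 1 else 0) * real_of_int (w i) * real_of_int (w j))" ..
qed auto

lemma rank_one_cone_mono:
  assumes g: "g \<in> rank_one_cone m' n K'" and le: "m \<le> m'" "K' \<le> K"
    and zero: "\<And>i j. i < m' \<or> j < m' \<Longrightarrow> g i j = 0"
  shows "g \<in> rank_one_cone m n K"
proof -
  obtain l where l: "\<forall>v. 0 \<le> l v" "\<forall>i\<in>{m'..<n}. \<forall>j\<in>{m'..<n}.
      g i j = (\<Sum>v\<in>int_box m' n K'. l v * real_of_int (v i) * real_of_int (v j))"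
    using g unfolding rank_one_cone_def by blast
  have sub: "int_box m' n K' \<subseteq> int_box m n K"
  proof
    fix v assume v: "v \<in> int_box m' n K'"
    have "\<bar>v i\<bar> \<le> int K" if "i \<in> {m..<n}" for i
    proof (cases "i < m'")
      case True
      then show ?thesis using v unfolding int_box_def by auto
    next
      case False
      then have "\<bar>v i\<bar> \<le> int K'" using v that unfolding int_box_def by auto
      then show ?thesis using le by linarith
    qed
    then show "v \<in> int_box m n K" using v le(1) unfolding int_box_def by auto
  qed
  show ?thesis
  proof (rule rank_one_coneI[of "\<lambda>v. if v \<in> int_box m' n K' then l v else 0"])
    fix i j assume ij: "i \<in> {m..<n}" "j \<in> {m..<n}"
    have "g i j = (\<Sum>v\<in>int_box m' n K'. l v * real_of_int (v i) * real_of_int (v j))"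
    proof (cases "i < m' \<or> j < m'")
      case True
      then have "(\<Sum>v\<in>int_box m' n K'. l v * real_of_int (v i) * real_of_int (v j)) = 0"
        by (intro sum.neutral) (auto simp: int_box_def)
      then show ?thesis using zero[OF True] by simp
    next
      case False
      then show ?thesis using l(2) ij by simp
    qed
    also have "\<dots> = (\<Sum>v\<in>int_box m n K. if v \<in> int_box m' n K' then l v * real_of_int (v i) * real_of_int (v j) else 0)"
      using sub finite_int_box by (simp add: sum.inter_restrict[symmetric] Int_absorb1)
    also have "\<dots> = (\<Sum>v\<in>int_box m n K. (if v \<in> int_box m' n K' then l v else 0) * real_of_int (v i) * real_of_int (v j))"
      by (intro sum.cong) auto
    finally show "g i j = \<dots>" .
  qed (simp add: l)
qed

lemma bilin_diag:
  assumes "finite I"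
  shows "bilin I (\<lambda>a b. if a = b then q a else 0) x x = (\<Sum>a\<in>I. q a * (x a)\<^sup>2)"
proof -
  have "bilin I (\<lambda>a b. if a = b then q a else 0) x x = (\<Sum>a\<in>I. \<Sum>b\<in>I. if a = b then q a * (x a)\<^sup>2 else 0)"
    unfolding bilin_def by (intro sum.cong) (auto simp: power2_eq_square)
  then show ?thesis using assms by simp
qed

text \<open>
  Induction on the number of variables. Complete the square, \<open>g = d u u\<^sup>T + G'\<close> with \<open>u\<^sub>m = 1\<close>, where the
  entries of \<open>u\<close> are bounded in terms of \<open>C/c\<close>. Round \<open>u\<close> down to a vector \<open>t = u - \<delta>\<close> with entries in
  \<open>(1/N) \<int>\<close>; then
  \<open>u u\<^sup>T = (1 - \<Sum> \<delta>\<^sub>j) t t\<^sup>T + \<Sum> \<delta>\<^sub>j (t + e\<^sub>j) (t + e\<^sub>j)\<^sup>T + (\<delta> \<delta>\<^sup>T - \<Sum> \<delta>\<^sub>j e\<^sub>j e\<^sub>j\<^sup>T)\<close>.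
  The first two terms have nonnegative coefficients and directions from a finite set. The bracket
  involves the later variables only and has entries of size at most \<open>1/N\<close>. Since the weights increase,
  adding \<open>d\<close> times the bracket to \<open>G'\<close> leaves a form that is still reduced, with \<open>c/2\<close> in place of \<open>c\<close>
  and a larger \<open>C\<close>, once \<open>N\<close> is large.
\<close>
theorem reduced_form_in_cone:
  assumes "m \<le> n" "0 < c" "0 < C"
  shows "\<exists>K. \<forall>g. reduced_form m n c C g \<longrightarrow> g \<in> rank_one_cone m n K"
  using assms
proof (induction arbitrary: c C rule: inc_induct)
  case base
  have "g \<in> rank_one_cone n n 0" for g
    by (rule rank_one_coneI[of "\<lambda>v. 0"]) auto
  then show ?case by blast
next
  case (step m)
  define I where "I = {Suc m..<n}"
  have I: "finite I" "m \<notin> I" "{m..<n} = insert m I"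
    using step.hyps unfolding I_def by auto
  have c: "0 < c" and C: "0 < C" using step.prems by auto
  define C' where "C' = 3 * C + C\<^sup>2 / c"
  have C': "0 < C'" using c C unfolding C'_def by (simp add: add_pos_pos)
  obtain K' where K': "\<And>g. reduced_form (Suc m) n (c / 2) C' g \<Longrightarrow> g \<in> rank_one_cone (Suc m) n K'"
    using step.IH[of "c / 2" C'] c C' by auto
  define N where "N = max (Suc n) (nat \<lceil>2 * C / c\<rceil>)"
  have N: "1 \<le> real N" "real (card I) \<le> real N" "2 * C / c \<le> real N"
    unfolding N_def I_def by (auto simp: le_max_iff_disj) linarith+
  define M where "M = nat \<lceil>real N * (C / c)\<rceil> + 1"
  define K where "K = max K' (M + N)"
  have "g \<in> rank_one_cone m n K" if "reduced_form m n c C g" for g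
  proof -
    from that obtain h where sym: "sym_form g" and h: "\<forall>i\<in>{m..<n}. 0 < h i"
     "\<forall>i\<in>{m..<n}. \<forall>j\<in>{m..<n}. i \<le> j \<longrightarrow> h i \<le> h j \<and> \<bar>g i j\<bar> \<le> C * h i"
     "\<And>x. c * (\<Sum>i\<in>{m..<n}. h i * (x i)\<^sup>2) \<le> bilin {m..<n} g x x"
      unfolding reduced_form_def by blast
    have hI: "h m \<le> h i" "0 < h i" "\<bar>g m i\<bar> \<le> C * h m" if "i \<in> I" for i
      using h(1,2) that step.hyps unfolding I_def by auto
    have hm: "0 < h m" using h(1) step.hyps by simp
    define d where "d = g m m"
    have d_le: "d \<le> C * h m" using h(2) step.hyps unfolding d_def by force
    have d_ge: "c * h m \<le> d"
    proof -
      define e where "e = (\<lambda>a. if a = m then 1 else 0 :: real)"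
      have "bilin I g e e = 0" using I(2) unfolding bilin_def e_def by (intro sum.neutral) auto
      moreover have "(\<Sum>a\<in>I. g m a * e a) = 0" using I(2) unfolding e_def by (intro sum.neutral) auto
      moreover have "(\<Sum>i\<in>I. h i * (e i)\<^sup>2) = 0" using I(2) unfolding e_def by (intro sum.neutral) auto
      ultimately show ?thesis
        using h(3)[of e] unfolding I(3) bilin_insert[OF I(1,2) sym] d_def using I(1,2) by (simp add: e_def)
    qed
    have d: "0 < d" using d_ge c hm by (meson less_le_trans mult_pos_pos)
    define u where "u i = (if i = m then 1 else g m i / d)" for i
    \<comment> \<open>the integral vector \<open>N t\<close>, where \<open>t = u - \<delta>\<close> is the rounded vector\<close>
    define z where "z i = (if i = m then int N else if i \<in> I then \<lfloor>real N * u i\<rfloor> else 0)" for i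
    define \<delta> where "\<delta> i = (if i \<in> I then u i - real_of_int (z i) / real N else 0)" for i
    have N0: "0 < real N" using N by simp
    have \<delta>: "0 \<le> \<delta> i" "\<delta> i \<le> 1 / real N" for i
    proof -
      have "0 \<le> \<delta> i \<and> \<delta> i \<le> 1 / real N"
      proof (cases "i \<in> I")
        case True
        then have "real_of_int (z i) \<le> real N * u i" "real N * u i \<le> real_of_int (z i) + 1"
          using I(2) of_int_floor_le[of "real N * u i"] real_of_int_floor_add_one_ge[of "real N * u i"]
          unfolding z_def by auto
        then have "real_of_int (z i) / real N \<le> u i" "u i \<le> (real_of_int (z i) + 1) / real N"
          using N0 by (simp_all add: pos_divide_le_eq pos_le_divide_eq mult.commute)
        then show ?thesis unfolding \<delta>_def using True by (simp add: add_divide_distrib)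
      next
        case False
        then show ?thesis unfolding \<delta>_def using N0 by simp
      qed
      then show "0 \<le> \<delta> i" "\<delta> i \<le> 1 / real N" by auto
    qed
    have \<delta>1: "\<delta> i \<le> 1" for i using \<delta>(2)[of i] N(1) by (smt (verit) divide_le_eq_1)
    have z: "real_of_int (z i) = real N * (u i - \<delta> i)" if "i \<in> {m..<n}" for i
      using that N0 I(2) unfolding \<delta>_def I(3) by (auto simp: z_def u_def)
    \<comment> \<open>the integral vector \<open>N (t + e\<^sub>j)\<close>\<close>
    define w where "w j i = z i + (if i = j then int N else 0)" for j i
    define g' where "g' i j = (if i \<in> I \<and> j \<in> I then g i j - g m i * g m j / d + d * \<delta> i * \<delta> j
        - (if i = j then d * \<delta> i else 0) else 0)" for i j
    have u_le: "\<bar>u i\<bar> \<le> C / c" if "i \<in> I" for i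
    proof -
      have "\<bar>g m i\<bar> * c \<le> C * h m * c" using hI(3)[OF that] c by simp
      also have "\<dots> \<le> C * d" using d_ge C by (simp add: mult.assoc mult.commute[of "h m"])
      finally show ?thesis using d c I(2) that unfolding u_def by (auto simp: abs_divide field_simps)
    qed
    have z_le: "\<bar>z i\<bar> \<le> int M" if "i \<in> I" for i
    proof -
      have "real N * \<bar>u i\<bar> \<le> real N * (C / c)" using u_le[OF that] by (intro mult_left_mono) auto
      then have "\<bar>real N * u i\<bar> \<le> real N * (C / c)" by (simp add: abs_mult)
      then have "\<bar>\<lfloor>real N * u i\<rfloor>\<bar> \<le> \<lceil>real N * (C / c)\<rceil> + 1" by linarith
      moreover have "0 \<le> real N * (C / c)" using c C by simp
      then have "int M = \<lceil>real N * (C / c)\<rceil> + 1" unfolding M_def by simp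
      moreover have "z i = \<lfloor>real N * u i\<rfloor>" using that I(2) unfolding z_def by auto
      ultimately show ?thesis by (simp only:)
    qed
    have z_box: "z \<in> int_box m n K"
    proof -
      have "\<bar>z i\<bar> \<le> int K" if "i \<in> {m..<n}" for i
        using that z_le[of i] unfolding I(3) K_def by (auto simp: z_def[of m])
      moreover have "z i = 0" if "i \<notin> {m..<n}" for i
        using that unfolding I(3) z_def by auto
      ultimately show ?thesis unfolding int_box_def by blast
    qed
    have w_box: "w j \<in> int_box m n K" if "j \<in> I" for j
    proof -
      have "\<bar>w j i\<bar> \<le> int K" if "i \<in> {m..<n}" for i
      proof (cases "i = m")
        case True
        then have "w j i = int N" using \<open>j \<in> I\<close> I(2) unfolding w_def z_def by auto
        then show ?thesis unfolding K_def by simp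
      next
        case False
        then have "\<bar>z i\<bar> \<le> int M" using z_le that I(3) by auto
        then show ?thesis unfolding w_def K_def by auto
      qed
      moreover have "w j i = 0" if "i \<notin> {m..<n}" for i
        using that \<open>j \<in> I\<close> unfolding I(3) w_def z_def by auto
      ultimately show ?thesis unfolding int_box_def by blast
    qed
    have "reduced_form (Suc m) n (c / 2) C' g'"
      unfolding reduced_form_def I_def[symmetric]
    proof (intro conjI exI[of _ h] ballI allI impI)
      show "sym_form g'" using sym unfolding sym_form_def g'_def by (auto simp: mult_ac)
    next
      fix i assume "i \<in> I"
      then show "0 < h i" using hI by blast
    next
      fix i j assume ij: "i \<in> I" "j \<in> I" "i \<le> j"
      show "h i \<le> h j" using h(2) ij unfolding I_def by auto
      have "\<bar>g i j\<bar> \<le> C * h i" using h(2) ij unfolding I_def by auto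
      moreover have "\<bar>g m i * g m j / d\<bar> \<le> C\<^sup>2 / c * h i"
      proof -
        have "\<bar>g m i\<bar> * \<bar>g m j\<bar> \<le> (C * h m) * (C * h m)"
          using hI(3) ij by (intro mult_mono) (auto intro: order_trans[OF abs_ge_zero])
        then have "\<bar>g m i * g m j\<bar> / d \<le> (C * h m) * (C * h m) / d"
          unfolding abs_mult using d by (intro divide_right_mono) auto
        also have "\<dots> \<le> (C * h m) * (C * h m) / (c * h m)"
          using d_ge c hm by (intro divide_left_mono) (auto intro: mult_pos_pos d)
        also have "\<dots> = C\<^sup>2 / c * h m" using hm c by (simp add: power2_eq_square field_simps)
        also have "\<dots> \<le> C\<^sup>2 / c * h i" using hI(1)[OF ij(1)] c by (intro mult_left_mono) auto
        finally show ?thesis using d by (simp add: abs_divide)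
      qed
      moreover have "\<bar>d * \<delta> i * \<delta> j\<bar> \<le> C * h i"
      proof -
        have "\<delta> i * \<delta> j \<le> 1 * 1" using \<delta> \<delta>1 by (intro mult_mono) auto
        then have "d * (\<delta> i * \<delta> j) \<le> d * 1" using d by (intro mult_left_mono) auto
        also have "\<dots> \<le> C * h m" using d_le by simp
        also have "\<dots> \<le> C * h i" using hI(1)[OF ij(1)] C by simp
        finally show ?thesis using d \<delta>(1) by (simp add: abs_mult mult.assoc)
      qed
      moreover have "\<bar>if i = j then d * \<delta> i else 0\<bar> \<le> C * h i"
      proof -
        have "d * \<delta> i \<le> d * 1" using d \<delta>1 by (intro mult_left_mono) auto
        also have "\<dots> \<le> C * h m" using d_le by simp
        also have "\<dots> \<le> C * h i" using hI(1)[OF ij(1)] C by simp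
        finally have "d * \<delta> i \<le> C * h i" .
        moreover have "0 \<le> d * \<delta> i" "0 \<le> C * h i"
          using d \<delta>(1) C hI(2)[OF ij(1)] by simp_all
        ultimately show ?thesis by (cases "i = j") (simp_all only: if_True if_False abs_of_nonneg abs_zero simp_thms)
      qed
      moreover have "C' * h i = C * h i + C\<^sup>2 / c * h i + C * h i + C * h i"
        unfolding C'_def by (simp add: algebra_simps)
      moreover have "g' i j = g i j - g m i * g m j / d + d * \<delta> i * \<delta> j - (if i = j then d * \<delta> i else 0)"
        using ij unfolding g'_def by simp
      ultimately show "\<bar>g' i j\<bar> \<le> C' * h i" by linarith
    next
      fix x :: "nat \<Rightarrow> real"
      define T where "T = (\<Sum>a\<in>I. g m a * x a)"
      define S where "S = (\<Sum>i\<in>I. h i * (x i)\<^sup>2)"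
      \<comment> \<open>at this value of the variable \<open>m\<close> the completed square vanishes\<close>
      define y where "y = x(m := - T / d)"
      have yI: "a \<in> I \<Longrightarrow> y a = x a" for a using I(2) unfolding y_def by auto
      have "bilin (insert m I) g y y = d * (- T / d)\<^sup>2 + 2 * (- T / d) * T + bilin I g x x"
        unfolding bilin_insert[OF I(1,2) sym] d_def[symmetric]
        using yI by (simp add: T_def y_def cong: sum.cong bilin_cong)
      also have "\<dots> = bilin I g x x - T\<^sup>2 / d"
        using d by (simp add: power2_eq_square field_simps)
      finally have 1: "bilin (insert m I) g y y = bilin I g x x - T\<^sup>2 / d" .
      have "S \<le> (\<Sum>i\<in>insert m I. h i * (y i)\<^sup>2)"
        using I(1,2) yI hm unfolding S_def by simp
      then have "c * S \<le> c * (\<Sum>i\<in>insert m I. h i * (y i)\<^sup>2)" using c by simp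
      then have 2: "c * S \<le> bilin I g x x - T\<^sup>2 / d" using h(3)[of y] 1 unfolding I(3) by linarith
      have "(\<Sum>i\<in>I. d * \<delta> i * (x i)\<^sup>2) \<le> (\<Sum>i\<in>I. C / real N * (h i * (x i)\<^sup>2))"
      proof (rule sum_mono)
        fix i assume i: "i \<in> I"
        have "d * \<delta> i \<le> (C * h m) * (1 / real N)"
          using d_le \<delta> d by (intro mult_mono) auto
        also have "\<dots> \<le> (C * h i) * (1 / real N)"
          using hI(1)[OF i] C by (intro mult_right_mono mult_left_mono) auto
        finally have "d * \<delta> i * (x i)\<^sup>2 \<le> (C * h i) * (1 / real N) * (x i)\<^sup>2"
          by (intro mult_right_mono) auto
        then show "d * \<delta> i * (x i)\<^sup>2 \<le> C / real N * (h i * (x i)\<^sup>2)" by (simp add: mult_ac)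
      qed
      also have "\<dots> = C / real N * S" unfolding S_def sum_distrib_left ..
      also have "\<dots> \<le> c / 2 * S"
      proof (rule mult_right_mono)
        show "C / real N \<le> c / 2" using N(3) N0 c by (simp add: field_simps)
        show "0 \<le> S" unfolding S_def using hI(2) by (intro sum_nonneg) (auto simp: less_imp_le)
      qed
      finally have 3: "(\<Sum>i\<in>I. d * \<delta> i * (x i)\<^sup>2) \<le> c / 2 * S" .
      have "bilin I g' x x = bilin I (\<lambda>i j. (g i j + (- 1 / d) * (g m i * g m j)) + (d * (\<delta> i * \<delta> j)
        + (-1) * (if i = j then d * \<delta> i else 0))) x x"
        by (rule bilin_cong) (auto simp: g'_def)
      also have "\<dots> = (bilin I g x x - T\<^sup>2 / d) + (d * (\<Sum>i\<in>I. \<delta> i * x i)\<^sup>2 - (\<Sum>i\<in>I. d * \<delta> i * (x i)\<^sup>2))"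
        unfolding bilin_add bilin_scale bilin_rank_one bilin_diag[OF I(1)] T_def
        by (simp add: power2_eq_square)
      also have "\<dots> \<ge> c * S - c / 2 * S" using 2 3 d by (smt (verit) mult_nonneg_nonneg zero_le_power2)
      finally show "c / 2 * (\<Sum>i\<in>I. h i * (x i)\<^sup>2) \<le> bilin I g' x x" unfolding S_def by simp
    qed
    then have "g' \<in> rank_one_cone (Suc m) n K'" by (rule K')
    then have g': "g' \<in> rank_one_cone m n K"
      by (rule rank_one_cone_mono) (auto simp: g'_def I_def K_def)
    define s where "s = (\<Sum>j\<in>I. \<delta> j)"
    have s1: "s \<le> 1"
    proof -
      have "s \<le> (\<Sum>j\<in>I. 1 / real N)" unfolding s_def using \<delta>(2) by (intro sum_mono) auto
      also have "\<dots> \<le> 1" using N(2) N0 by (simp add: field_simps)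
      finally show ?thesis .
    qed
    have "(\<lambda>i k. (d * (1 - s) / (real N)\<^sup>2) * (real_of_int (z i) * real_of_int (z k))) \<in> rank_one_cone m n K"
      using z_box s1 d by (intro rank_one_cone_scale rank_one_cone_generator) auto
    moreover have "(\<lambda>i k. \<Sum>j\<in>I. (d * \<delta> j / (real N)\<^sup>2) * (real_of_int (w j i) * real_of_int (w j k))) \<in> rank_one_cone m n K"
      using w_box \<delta>(1) d I(1) by (intro rank_one_cone_sum rank_one_cone_scale rank_one_cone_generator) auto
    ultimately have "(\<lambda>i k. ((d * (1 - s) / (real N)\<^sup>2) * (real_of_int (z i) * real_of_int (z k))
       + (\<Sum>j\<in>I. (d * \<delta> j / (real N)\<^sup>2) * (real_of_int (w j i) * real_of_int (w j k)))) + g' i k) \<in> rank_one_cone m n K"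
      using g' by (intro rank_one_cone_add)
    then show ?thesis
    proof (rule rank_one_cone_cong)
      fix i k assume ik: "i \<in> {m..<n}" "k \<in> {m..<n}"
      let ?z = "\<lambda>i. real_of_int (z i)" and ?N = "real N"
      have pick: "(\<Sum>j\<in>I. \<delta> j * (if i = j then q else 0)) = \<delta> i * q" for i q
        using I(1) by (simp add: \<delta>_def if_distrib[of "\<lambda>t. _ * t"] cong: if_cong)
      have pick2: "(\<Sum>j\<in>I. \<delta> j * ((if i = j then q else 0) * (if k = j then q else 0))) = (if i = k then \<delta> i * q\<^sup>2 else 0)" for q
      proof -
        have "(\<Sum>j\<in>I. \<delta> j * ((if i = j then q else 0) * (if k = j then q else 0))) =
              (\<Sum>j\<in>I. \<delta> j * (if i = j then (if i = k then q\<^sup>2 else 0) else 0))"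
          by (intro sum.cong) (auto simp: power2_eq_square)
        then show ?thesis unfolding pick by simp
      qed
      have "(\<Sum>j\<in>I. \<delta> j * (real_of_int (w j i) * real_of_int (w j k))) =
        (\<Sum>j\<in>I. \<delta> j * (?z i * ?z k) + ?z i * (\<delta> j * (if k = j then ?N else 0)) + ?z k * (\<delta> j * (if i = j then ?N else 0))
          + \<delta> j * ((if i = j then ?N else 0) * (if k = j then ?N else 0)))"
        by (intro sum.cong) (auto simp: w_def algebra_simps)
      also have "\<dots> = s * (?z i * ?z k) + ?z i * (\<delta> k * ?N) + ?z k * (\<delta> i * ?N) + (if i = k then \<delta> i * ?N\<^sup>2 else 0)"
        unfolding sum.distrib sum_distrib_left[symmetric] sum_distrib_right[symmetric] pick pick2 s_def ..
      finally have W: "(\<Sum>j\<in>I. \<delta> j * (real_of_int (w j i) * real_of_int (w j k))) = \<dots>" .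
      have "(d * (1 - s) / ?N\<^sup>2) * (?z i * ?z k) + (\<Sum>j\<in>I. (d * \<delta> j / ?N\<^sup>2) * (real_of_int (w j i) * real_of_int (w j k)))
        = d / ?N\<^sup>2 * ((1 - s) * (?z i * ?z k) + (\<Sum>j\<in>I. \<delta> j * (real_of_int (w j i) * real_of_int (w j k))))"
        by (simp add: distrib_left sum_distrib_left mult_ac)
      also have "\<dots> = d / ?N\<^sup>2 * (?N\<^sup>2 * (u i * u k - \<delta> i * \<delta> k + (if i = k then \<delta> i else 0)))"
        unfolding W z[OF ik(1)] z[OF ik(2)] by (auto simp: power2_eq_square algebra_simps)
      also have "\<dots> = d * u i * u k - d * \<delta> i * \<delta> k + (if i = k then d * \<delta> i else 0)"
        using N0 by (simp add: algebra_simps)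
      finally have main: "(d * (1 - s) / ?N\<^sup>2) * (?z i * ?z k) + (\<Sum>j\<in>I. (d * \<delta> j / ?N\<^sup>2) * (real_of_int (w j i) * real_of_int (w j k)))
        = d * u i * u k - d * \<delta> i * \<delta> k + (if i = k then d * \<delta> i else 0)" .
      have "g' i k = g i k - (d * u i * u k - d * \<delta> i * \<delta> k + (if i = k then d * \<delta> i else 0))"
      proof (cases "i \<in> I \<and> k \<in> I")
        case True
        then have "d * u i * u k = g m i * g m k / d" using I(2) d unfolding u_def by auto
        then show ?thesis using True unfolding g'_def by simp
      next
        case False
        then have "i = m \<or> k = m" using ik I(3) by auto
        then have "g i k = d * u i * u k" "\<delta> i * \<delta> k = 0" "i = k \<Longrightarrow> \<delta> i = 0"
          using d sym I(2) unfolding u_def d_def \<delta>_def sym_form_def by auto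
        then show ?thesis using False unfolding g'_def by auto
      qed
      then show "g i k = ((d * (1 - s) / ?N\<^sup>2) * (?z i * ?z k)
       + (\<Sum>j\<in>I. (d * \<delta> j / ?N\<^sup>2) * (real_of_int (w j i) * real_of_int (w j k)))) + g' i k"
        unfolding main by simp
    qed
  qed
  then show ?case by blast
qed

section \<open>Representations and orthogonal sums\<close>

definition linear_map :: "nat \<Rightarrow> nat \<Rightarrow> (int vec \<Rightarrow> int vec) \<Rightarrow> bool" where
  "linear_map n k f \<longleftrightarrow> (\<forall>x\<in>carrier_vec n. f x \<in> carrier_vec k) \<and>
     (\<forall>x\<in>carrier_vec n. \<forall>y\<in>carrier_vec n. f (x + y) = f x + f y) \<and>
     (\<forall>c. \<forall>x\<in>carrier_vec n. f (c \<cdot>\<^sub>v x) = c \<cdot>\<^sub>v f x)"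

text \<open>
  The form \<open>\<beta>\<close> is the pullback of the form of \<open>A\<close> along a linear map, which may have a kernel. Unlike
  representability this is additive under orthogonal sums.
\<close>
definition realizes :: "int mat \<Rightarrow> nat \<Rightarrow> (int vec \<Rightarrow> int vec \<Rightarrow> int) \<Rightarrow> bool" where
  "realizes A n \<beta> \<longleftrightarrow> (\<exists>f. linear_map n (lat_rank A) f \<and>
     (\<forall>x\<in>carrier_vec n. \<forall>y\<in>carrier_vec n. lat_form A (f x) (f y) = \<beta> x y))"

lemma is_lattice_carrier: "is_lattice G \<Longrightarrow> G \<in> carrier_mat (lat_rank G) (lat_rank G)"
  unfolding is_lattice_def by auto

lemma lat_form_zero: "lat_form G (0\<^sub>v (lat_rank G)) y = 0"
  unfolding lat_form_def scalar_prod_def by simp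

lemma lat_form_bilin:
  assumes "G \<in> carrier_mat n n" "x \<in> carrier_vec n" "y \<in> carrier_vec n"
  shows "lat_form G x y = bilin {0..<n} (\<lambda>i j. G $$ (i, j)) (\<lambda>i. x $ i) (\<lambda>i. y $ i)"
  using assms unfolding lat_form_def scalar_prod_def bilin_def
  by (auto simp: scalar_prod_def sum_distrib_left mult_ac intro!: sum.cong)

lemma representation_linear:
  assumes "is_representation l L f"
  shows "linear_map (lat_rank l) (lat_rank L) f"
  using assms unfolding is_representation_def linear_map_def lat_vecs_def by blast

lemma linear_map_zero: "linear_map n k f \<Longrightarrow> f (0\<^sub>v n) = 0\<^sub>v k"
proof -
  assume f: "linear_map n k f"
  have "f (0 \<cdot>\<^sub>v 0\<^sub>v n) = 0 \<cdot>\<^sub>v f (0\<^sub>v n)" using f unfolding linear_map_def by auto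
  moreover have "0 \<cdot>\<^sub>v (0\<^sub>v n :: int vec) = 0\<^sub>v n" by auto
  moreover have "f (0\<^sub>v n) \<in> carrier_vec k" using f unfolding linear_map_def by auto
  then have "0 \<cdot>\<^sub>v f (0\<^sub>v n) = 0\<^sub>v k" by (intro eq_vecI) auto
  ultimately show ?thesis by simp
qed

lemma linear_map_comp:
  assumes "linear_map n k f" "linear_map k m g"
  shows "linear_map n m (g \<circ> f)"
  using assms unfolding linear_map_def by auto

text \<open>A linear map that preserves a positive definite form is injective.\<close>
lemma represents_of_realizes:
  assumes l: "is_lattice l" "lat_rank l = n" and L: "is_lattice L" and r: "realizes L n (lat_form l)"
  shows "represents L l"
proof -
  obtain f where f: "linear_map n (lat_rank L) f"
      "\<And>x y. x \<in> carrier_vec n \<Longrightarrow> y \<in> carrier_vec n \<Longrightarrow> lat_form L (f x) (f y) = lat_form l x y"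
    using r unfolding realizes_def by blast
  have "inj_on f (carrier_vec n)"
  proof (rule inj_onI)
    fix x y assume xy: "x \<in> carrier_vec n" "y \<in> carrier_vec n" "f x = f y"
    let ?z = "x + (-1) \<cdot>\<^sub>v y"
    have z: "?z \<in> carrier_vec n" using xy by auto
    have "f ?z = f x + (-1) \<cdot>\<^sub>v f y"
      using f(1) xy unfolding linear_map_def by (metis smult_carrier_vec)
    moreover have "f y \<in> carrier_vec (lat_rank L)" using f(1) xy unfolding linear_map_def by auto
    ultimately have "f ?z = 0\<^sub>v (lat_rank L)" unfolding xy(3) by auto
    then have "lat_form l ?z ?z = 0" using f(2)[OF z z] lat_form_zero[of L] by simp
    then have z0: "?z = 0\<^sub>v n" using l z unfolding is_lattice_def lat_vecs_def by force
    have "x $ i = y $ i" if "i < n" for i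
    proof -
      have "?z $ i = x $ i - y $ i" using xy that by simp
      moreover have "?z $ i = 0" unfolding z0 using that by simp
      ultimately show ?thesis by simp
    qed
    then show "x = y" using xy by (intro eq_vecI) auto
  qed
  then have "is_representation l L f"
    using f l(2) unfolding is_representation_def linear_map_def lat_vecs_def by auto
  then show ?thesis unfolding represents_def by blast
qed

lemma represents_trans:
  assumes "represents A B" "represents B C"
  shows "represents A C"
proof -
  obtain f where f: "is_representation B A f" using assms(1) unfolding represents_def by blast
  obtain g where g: "is_representation C B g" using assms(2) unfolding represents_def by blast
  have "inj_on (f \<circ> g) (lat_vecs C)"
    using f g unfolding is_representation_def by (auto intro!: comp_inj_on intro: inj_on_subset)
  then have "is_representation C A (f \<circ> g)"
    using f g unfolding is_representation_def by (auto simp: image_subset_iff)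
  then show ?thesis unfolding represents_def by blast
qed

lemma lat_rank_orth_sum [simp]: "lat_rank (orth_sum A B) = lat_rank A + lat_rank B"
  unfolding orth_sum_def by simp

lemma vec_first_append [simp]: "a \<in> carrier_vec k \<Longrightarrow> vec_first (a @\<^sub>v b) k = a"
  unfolding vec_first_def by (intro eq_vecI) auto

lemma vec_last_append [simp]: "b \<in> carrier_vec m \<Longrightarrow> vec_last (a @\<^sub>v b) m = b"
  unfolding vec_last_def by (intro eq_vecI) auto

lemma linear_map_vec_first: "linear_map (a + b) a (\<lambda>v. vec_first v a)"
  unfolding linear_map_def vec_first_def by (auto intro!: eq_vecI)

lemma linear_map_vec_last: "linear_map (a + b) b (\<lambda>v. vec_last v b)"
  unfolding linear_map_def vec_last_def
proof (intro conjI ballI allI)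
  fix x y :: "int vec" assume xy: "x \<in> carrier_vec (a + b)" "y \<in> carrier_vec (a + b)"
  then have "dim_vec x = a + b" "dim_vec y = a + b" by auto
  then show "vec b (\<lambda>i. (x + y) $ (dim_vec (x + y) - b + i)) =
      vec b (\<lambda>i. x $ (dim_vec x - b + i)) + vec b (\<lambda>i. y $ (dim_vec y - b + i))"
    by (intro eq_vecI) auto
next
  fix c :: int and x :: "int vec" assume "x \<in> carrier_vec (a + b)"
  then have "dim_vec x = a + b" by auto
  then show "vec b (\<lambda>i. (c \<cdot>\<^sub>v x) $ (dim_vec (c \<cdot>\<^sub>v x) - b + i)) =
      c \<cdot>\<^sub>v vec b (\<lambda>i. x $ (dim_vec x - b + i))"
    by (intro eq_vecI) auto
qed auto

lemma is_lattice_orth_sum: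
  assumes A: "is_lattice A" and B: "is_lattice B"
  shows "is_lattice (orth_sum A B)"
proof -
  have cA: "A \<in> carrier_mat (lat_rank A) (lat_rank A)" and cB: "B \<in> carrier_mat (lat_rank B) (lat_rank B)"
    by (rule is_lattice_carrier[OF A], rule is_lattice_carrier[OF B])
  have "square_mat (orth_sum A B)"
    using carrier_matD(2)[OF cA] carrier_matD(2)[OF cB] unfolding orth_sum_def by simp
  moreover have "transpose_mat (orth_sum A B) = orth_sum A B"
    unfolding orth_sum_def transpose_four_block_mat[OF cA zero_carrier_mat zero_carrier_mat cB]
    using A B unfolding is_lattice_def by simp
  moreover have "0 < lat_form (orth_sum A B) x x"
    if x: "x \<in> lat_vecs (orth_sum A B)" "x \<noteq> 0\<^sub>v (lat_rank (orth_sum A B))" for x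
  proof -
    let ?a = "vec_first x (lat_rank A)" and ?b = "vec_last x (lat_rank B)"
    have e: "x = ?a @\<^sub>v ?b" using x(1) unfolding lat_vecs_def by simp
    have ab: "?a \<in> lat_vecs A" "?b \<in> lat_vecs B" unfolding lat_vecs_def by auto
    have nonneg: "0 \<le> lat_form A ?a ?a" "0 \<le> lat_form B ?b ?b"
      using A B ab lat_form_zero[of A] lat_form_zero[of B] unfolding is_lattice_def
      by (metis less_imp_le order_refl)+
    have "?a \<noteq> 0\<^sub>v (lat_rank A) \<or> ?b \<noteq> 0\<^sub>v (lat_rank B)"
    proof (rule ccontr)
      assume "\<not> ?thesis"
      then have "x = 0\<^sub>v (lat_rank A) @\<^sub>v 0\<^sub>v (lat_rank B)" using e by simp
      also have "\<dots> = 0\<^sub>v (lat_rank A + lat_rank B)" by (intro eq_vecI) auto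
      finally show False using x(2) by simp
    qed
    then have "0 < lat_form A ?a ?a \<or> 0 < lat_form B ?b ?b"
      using A B ab unfolding is_lattice_def by blast
    then show ?thesis
      using lat_form_orth_sum[OF A B ab(1) ab(1) ab(2) ab(2)] e nonneg by fastforce
  qed
  ultimately show ?thesis unfolding is_lattice_def by blast
qed

lemma realizes_orth_sum:
  assumes A: "is_lattice A" and B: "is_lattice B" and r: "realizes A n \<beta>" "realizes B n \<gamma>"
  shows "realizes (orth_sum A B) n (\<lambda>x y. \<beta> x y + \<gamma> x y)"
proof -
  obtain f where f: "linear_map n (lat_rank A) f"
      "\<And>x y. x \<in> carrier_vec n \<Longrightarrow> y \<in> carrier_vec n \<Longrightarrow> lat_form A (f x) (f y) = \<beta> x y"
    using r(1) unfolding realizes_def by blast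
  obtain g where g: "linear_map n (lat_rank B) g"
      "\<And>x y. x \<in> carrier_vec n \<Longrightarrow> y \<in> carrier_vec n \<Longrightarrow> lat_form B (g x) (g y) = \<gamma> x y"
    using r(2) unfolding realizes_def by blast
  have fc: "f x \<in> carrier_vec (lat_rank A)" and gc: "g x \<in> carrier_vec (lat_rank B)"
    if "x \<in> carrier_vec n" for x using f(1) g(1) that unfolding linear_map_def by auto
  have "linear_map n (lat_rank (orth_sum A B)) (\<lambda>x. f x @\<^sub>v g x)"
    unfolding linear_map_def
  proof (intro conjI ballI allI)
    fix x y :: "int vec" assume xy: "x \<in> carrier_vec n" "y \<in> carrier_vec n"
    show "f (x + y) @\<^sub>v g (x + y) = (f x @\<^sub>v g x) + (f y @\<^sub>v g y)"
      using append_vec_add[OF fc[OF xy(1)] fc[OF xy(2)] gc[OF xy(1)] gc[OF xy(2)]] f(1) g(1) xy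
      unfolding linear_map_def by simp
  next
    fix c :: int and x :: "int vec" assume x: "x \<in> carrier_vec n"
    have "f (c \<cdot>\<^sub>v x) = c \<cdot>\<^sub>v f x" "g (c \<cdot>\<^sub>v x) = c \<cdot>\<^sub>v g x"
      using f(1) g(1) x unfolding linear_map_def by auto
    then show "f (c \<cdot>\<^sub>v x) @\<^sub>v g (c \<cdot>\<^sub>v x) = c \<cdot>\<^sub>v (f x @\<^sub>v g x)"
      using fc[OF x] gc[OF x] by (intro eq_vecI) auto
  qed (auto simp: fc gc)
  moreover have "lat_form (orth_sum A B) (f x @\<^sub>v g x) (f y @\<^sub>v g y) = \<beta> x y + \<gamma> x y"
    if "x \<in> carrier_vec n" "y \<in> carrier_vec n" for x y
    using lat_form_orth_sum[OF A B, of "f x" "f y" "g x" "g y"] fc gc f(2) g(2) that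
    unfolding lat_vecs_def by simp
  ultimately show ?thesis unfolding realizes_def by blast
qed

text \<open>One of the two components of the representation vanishes, so the other one is a representation.\<close>
lemma indecomposable_orth_sum:
  assumes E: "additively_indecomposable E" and A: "is_lattice A" and B: "is_lattice B"
    and EL: "is_lattice E"
    and r: "represents (orth_sum A B) E"
  shows "represents A E \<or> represents B E"
proof -
  obtain f where f: "is_representation E (orth_sum A B) f" using r unfolding represents_def by blast
  define n where "n = lat_rank E"
  have lin: "linear_map n (lat_rank A + lat_rank B) f"
    using representation_linear[OF f] n_def by simp
  let ?a = "\<lambda>x. vec_first (f x) (lat_rank A)" and ?b = "\<lambda>x. vec_last (f x) (lat_rank B)"
  have fx: "f x = ?a x @\<^sub>v ?b x" if "x \<in> carrier_vec n" for x
    using lin that unfolding linear_map_def by simp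
  have lina: "linear_map n (lat_rank A) ?a" and linb: "linear_map n (lat_rank B) ?b"
    using linear_map_comp[OF lin linear_map_vec_first] linear_map_comp[OF lin linear_map_vec_last]
    by (simp_all add: comp_def)
  have form: "lat_form A (?a x) (?a y) + lat_form B (?b x) (?b y) = lat_form E x y"
    if "x \<in> carrier_vec n" "y \<in> carrier_vec n" for x y
  proof -
    have "lat_form A (?a x) (?a y) + lat_form B (?b x) (?b y) = lat_form (orth_sum A B) (f x) (f y)"
      using lat_form_orth_sum[OF A B, of "?a x" "?a y" "?b x" "?b y"] fx[OF that(1)] fx[OF that(2)]
      unfolding lat_vecs_def by simp
    then show ?thesis using f that unfolding is_representation_def lat_vecs_def n_def by simp
  qed
  have "proj_image1 E f A = {0\<^sub>v (lat_rank A)} \<or> proj_image2 E f B = {0\<^sub>v (lat_rank B)}"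
    using E A B f unfolding additively_indecomposable_def by blast
  then show ?thesis
  proof
    assume "proj_image1 E f A = {0\<^sub>v (lat_rank A)}"
    then have "?a x = 0\<^sub>v (lat_rank A)" if "x \<in> carrier_vec n" for x
      using that unfolding proj_image1_def lat_vecs_def n_def by blast
    then have "realizes B n (lat_form E)"
      unfolding realizes_def using linb form lat_form_zero[of A] by (metis add_0)
    then show ?thesis using represents_of_realizes[OF EL _ B] n_def by blast
  next
    assume "proj_image2 E f B = {0\<^sub>v (lat_rank B)}"
    then have "?b x = 0\<^sub>v (lat_rank B)" if "x \<in> carrier_vec n" for x
      using that unfolding proj_image2_def lat_vecs_def n_def by blast
    then have "realizes A n (lat_form E)"
      unfolding realizes_def using lina form lat_form_zero[of B] by (metis add_0_right)
    then show ?thesis using represents_of_realizes[OF EL _ A] n_def by blast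
  qed
qed

text \<open>
  The orthogonal sum of a finite family, described by the two properties that matter: which
  indecomposable lattices it represents, and that it realizes the sum of forms realized by its members.
\<close>
lemma ex_orthogonal_sum_of_family:
  assumes "finite K" "\<And>k. k \<in> K \<Longrightarrow> is_lattice (A k)"
  shows "\<exists>L. is_lattice L \<and>
    (\<forall>E. is_lattice E \<and> additively_indecomposable E \<and> 0 < lat_rank E \<and> represents L E \<longrightarrow> (\<exists>k\<in>K. represents (A k) E)) \<and>
    (\<forall>n \<beta>. (\<forall>k\<in>K. realizes (A k) n (\<beta> k)) \<longrightarrow> realizes L n (\<lambda>x y. \<Sum>k\<in>K. \<beta> k x y))"
  using assms
proof (induction K rule: finite_induct)
  case empty
  let ?L = "0\<^sub>m 0 0 :: int mat"
  have vec0: "x = 0\<^sub>v 0" if "x \<in> carrier_vec 0" for x :: "int vec" using that by auto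
  have L: "is_lattice ?L" unfolding is_lattice_def lat_vecs_def using vec0 by auto
  moreover have "\<not> represents ?L E" if E: "0 < lat_rank E" for E
  proof
    assume "represents ?L E"
    then obtain f where f: "is_representation E ?L f" unfolding represents_def by blast
    have u: "unit_vec (lat_rank E) 0 \<in> lat_vecs E" "0\<^sub>v (lat_rank E) \<in> lat_vecs E"
      unfolding lat_vecs_def by auto
    have "f x = 0\<^sub>v 0" if "x \<in> lat_vecs E" for x
      using f that vec0 unfolding is_representation_def lat_vecs_def by (simp add: image_subset_iff)
    then have "f (unit_vec (lat_rank E) 0) = f (0\<^sub>v (lat_rank E))" using u by simp
    then have "unit_vec (lat_rank E) 0 = (0\<^sub>v (lat_rank E) :: int vec)"
      using f u unfolding is_representation_def inj_on_def by blast
    then have "unit_vec (lat_rank E) 0 $ 0 = (0\<^sub>v (lat_rank E) :: int vec) $ 0" by simp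
    then show False using E by simp
  qed
  moreover have "realizes ?L n (\<lambda>x y. 0)" for n
    unfolding realizes_def linear_map_def
    using lat_form_zero[of ?L] by (intro exI[of _ "\<lambda>x. 0\<^sub>v 0"]) auto
  ultimately show ?case by (intro exI[of _ ?L]) auto
next
  case (insert k K)
  then obtain L where L: "is_lattice L"
    "\<forall>E. is_lattice E \<and> additively_indecomposable E \<and> 0 < lat_rank E \<and> represents L E \<longrightarrow> (\<exists>k\<in>K. represents (A k) E)"
    "\<forall>n \<beta>. (\<forall>k\<in>K. realizes (A k) n (\<beta> k)) \<longrightarrow> realizes L n (\<lambda>x y. \<Sum>k\<in>K. \<beta> k x y)"
    by auto
  have Ak: "is_lattice (A k)" using insert.prems by simp
  show ?case
  proof (intro exI[of _ "orth_sum (A k) L"] conjI allI impI)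
    show "is_lattice (orth_sum (A k) L)" using is_lattice_orth_sum Ak L(1) .
  next
    fix E assume "is_lattice E \<and> additively_indecomposable E \<and> 0 < lat_rank E \<and> represents (orth_sum (A k) L) E"
    then show "\<exists>k\<in>insert k K. represents (A k) E"
      using indecomposable_orth_sum[OF _ Ak L(1)] L(2) by blast
  next
    fix n and \<beta> :: "_ \<Rightarrow> int vec \<Rightarrow> int vec \<Rightarrow> int"
    assume "\<forall>k\<in>insert k K. realizes (A k) n (\<beta> k)"
    then have "realizes (orth_sum (A k) L) n (\<lambda>x y. \<beta> k x y + (\<Sum>k\<in>K. \<beta> k x y))"
      using L(3) by (intro realizes_orth_sum Ak L(1)) auto
    then show "realizes (orth_sum (A k) L) n (\<lambda>x y. \<Sum>k\<in>insert k K. \<beta> k x y)"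
      using insert.hyps by simp
  qed
qed

lemma linear_map_matrix:
  assumes f: "linear_map n k f"
  shows "\<exists>A\<in>carrier_mat k n. \<forall>x\<in>carrier_vec n. f x = A *\<^sub>v x"
proof -
  define A where "A = mat k n (\<lambda>(i, j). f (unit_vec n j) $ i)"
  have A: "A \<in> carrier_mat k n" unfolding A_def by simp
  have fc: "f x \<in> carrier_vec k" if "x \<in> carrier_vec n" for x
    using f that unfolding linear_map_def by blast
  have "f x = A *\<^sub>v x" if x: "x \<in> carrier_vec n" for x
  proof -
    define tr where "tr q = vec n (\<lambda>i. if i < q then x $ i else 0)" for q
    have tr: "tr q \<in> carrier_vec n" for q unfolding tr_def by simp
    have "f (tr q) = A *\<^sub>v tr q" if "q \<le> n" for q
      using that
    proof (induction q)
      case 0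
      have "tr 0 = 0\<^sub>v n" unfolding tr_def by auto
      then show ?case using linear_map_zero[OF f] A by auto
    next
      case (Suc q)
      have s: "tr (Suc q) = tr q + x $ q \<cdot>\<^sub>v unit_vec n q"
        unfolding tr_def using Suc.prems by (intro eq_vecI) (auto simp: less_Suc_eq)
      have "f (unit_vec n q) = col A q"
        using Suc.prems fc[of "unit_vec n q"] unfolding A_def by (intro eq_vecI) auto
      also have "\<dots> = A *\<^sub>v unit_vec n q"
        using Suc.prems A by (auto intro!: eq_vecI)
      finally have u: "f (unit_vec n q) = A *\<^sub>v unit_vec n q" .
      have "f (tr (Suc q)) = f (tr q) + x $ q \<cdot>\<^sub>v f (unit_vec n q)"
        using f tr[of q] unfolding s linear_map_def by (metis smult_carrier_vec unit_vec_carrier)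
      also have "\<dots> = A *\<^sub>v tr q + x $ q \<cdot>\<^sub>v (A *\<^sub>v unit_vec n q)" using Suc u by simp
      also have "\<dots> = A *\<^sub>v tr (Suc q)"
        unfolding s using A tr[of q]
        by (auto simp: mult_add_distrib_mat_vec[OF A] intro!: eq_vecI)
      finally show ?case .
    qed
    moreover have "tr n = x" using x unfolding tr_def by auto
    ultimately show ?thesis by (metis order_refl)
  qed
  then show ?thesis using A by blast
qed

text \<open>The determinant of the map works as \<open>D\<close>, by means of the adjugate matrix.\<close>
lemma injective_linear_map_finite_index:
  assumes f: "linear_map n n f" and inj: "inj_on f (carrier_vec n)"
  shows "\<exists>D\<noteq>0. \<forall>y\<in>carrier_vec n. \<exists>x\<in>carrier_vec n. f x = D \<cdot>\<^sub>v y"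
proof -
  obtain A where A: "A \<in> carrier_mat n n" "\<And>x. x \<in> carrier_vec n \<Longrightarrow> f x = A *\<^sub>v x"
    using linear_map_matrix[OF f] by blast
  have "det A \<noteq> 0"
  proof
    assume "det A = 0"
    then obtain v where v: "v \<in> carrier_vec n" "v \<noteq> 0\<^sub>v n" "A *\<^sub>v v = 0\<^sub>v n"
      using det_0_iff_vec_prod_zero[OF A(1)] by blast
    then have "f v = f (0\<^sub>v n)" using A(2) linear_map_zero[OF f] by simp
    then show False using inj v unfolding inj_on_def by auto
  qed
  moreover have "\<exists>x\<in>carrier_vec n. f x = det A \<cdot>\<^sub>v y" if y: "y \<in> carrier_vec n" for y
  proof (intro bexI)
    show x: "adj_mat A *\<^sub>v y \<in> carrier_vec n" using adj_mat(1)[OF A(1)] y by auto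
    have "f (adj_mat A *\<^sub>v y) = (A * adj_mat A) *\<^sub>v y"
      using A(2)[OF x] adj_mat(1)[OF A(1)] A(1) y by (simp add: assoc_mult_mat_vec)
    also have "\<dots> = det A \<cdot>\<^sub>v y"
      unfolding adj_mat(2)[OF A(1)]
    proof (rule eq_vecI)
      fix i assume "i < dim_vec (det A \<cdot>\<^sub>v y)"
      then have i: "i < n" using y by simp
      then have "((det A \<cdot>\<^sub>m 1\<^sub>m n) *\<^sub>v y) $ i = (\<Sum>j\<in>{0..<n}. det A * (if j = i then 1 else 0) * y $ j)"
        using y by (simp add: scalar_prod_def)
      also have "\<dots> = (\<Sum>j\<in>{0..<n}. if j = i then det A * y $ j else 0)"
        by (intro sum.cong) auto
      finally show "((det A \<cdot>\<^sub>m 1\<^sub>m n) *\<^sub>v y) $ i = (det A \<cdot>\<^sub>v y) $ i" using i y by simp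
    qed (use y in simp)
    finally show "f (adj_mat A *\<^sub>v y) = det A \<cdot>\<^sub>v y" .
  qed
  ultimately show ?thesis by blast
qed

text \<open>
  If a projection of \<open>l\<close> vanished on the image of \<open>E\<close>, which contains \<open>D l\<close> for some \<open>D \<noteq> 0\<close>, it would
  vanish on \<open>l\<close>, because the target is torsion-free.
\<close>
lemma decomposable_not_represents:
  assumes E: "additively_indecomposable E" and rank: "lat_rank E = lat_rank l"
    and L: "is_lattice L1" "is_lattice L2" and f: "is_representation l (orth_sum L1 L2) f"
    and p1: "proj_image1 l f L1 \<noteq> {0\<^sub>v (lat_rank L1)}" and p2: "proj_image2 l f L2 \<noteq> {0\<^sub>v (lat_rank L2)}"
  shows "\<not> represents l E"
proof
  assume "represents l E"
  then obtain g where g: "is_representation E l g" unfolding represents_def by blast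
  define n where "n = lat_rank l"
  have lg: "linear_map n n g" using representation_linear[OF g] rank n_def by simp
  have "inj_on g (carrier_vec n)" using g rank unfolding is_representation_def lat_vecs_def n_def by simp
  then obtain D where D: "D \<noteq> 0" "\<And>y. y \<in> carrier_vec n \<Longrightarrow> \<exists>x\<in>carrier_vec n. g x = D \<cdot>\<^sub>v y"
    using injective_linear_map_finite_index[OF lg] by blast
  have lf: "linear_map n (lat_rank L1 + lat_rank L2) f"
    using representation_linear[OF f] n_def by simp
  have cancel: "u = 0\<^sub>v k" if "D \<cdot>\<^sub>v u = 0\<^sub>v k" "u \<in> carrier_vec k" for u k
  proof (rule eq_vecI)
    fix i assume "i < dim_vec (0\<^sub>v k :: int vec)"
    then have i: "i < k" "i < dim_vec u" using that(2) by auto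
    then have "D * u $ i = (D \<cdot>\<^sub>v u) $ i" by simp
    also have "\<dots> = 0" unfolding that(1) using i by simp
    finally show "u $ i = 0\<^sub>v k $ i" using D(1) i by simp
  qed (use that in auto)
  have kill: "h (f y) = 0\<^sub>v k"
    if h: "linear_map (lat_rank L1 + lat_rank L2) k h" and z: "\<And>x. x \<in> carrier_vec n \<Longrightarrow> h (f (g x)) = 0\<^sub>v k"
      and y: "y \<in> carrier_vec n" for h k y
  proof -
    obtain x where x: "x \<in> carrier_vec n" "g x = D \<cdot>\<^sub>v y" using D(2)[OF y] by blast
    have fy: "f y \<in> carrier_vec (lat_rank L1 + lat_rank L2)" using lf y unfolding linear_map_def by blast
    have "D \<cdot>\<^sub>v h (f y) = h (f (D \<cdot>\<^sub>v y))" using lf h y fy unfolding linear_map_def by simp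
    also have "\<dots> = 0\<^sub>v k" using z[OF x(1)] x(2) by simp
    finally show ?thesis using cancel h fy unfolding linear_map_def by blast
  qed
  have ne: "lat_vecs l \<noteq> {}" unfolding lat_vecs_def using zero_carrier_vec by blast
  have inj: "inj_on (f \<circ> g) (lat_vecs E)"
    using f g unfolding is_representation_def by (auto intro!: comp_inj_on intro: inj_on_subset)
  then have "is_representation E (orth_sum L1 L2) (f \<circ> g)"
    using f g unfolding is_representation_def by (auto simp: image_subset_iff)
  then have "proj_image1 E (f \<circ> g) L1 = {0\<^sub>v (lat_rank L1)} \<or> proj_image2 E (f \<circ> g) L2 = {0\<^sub>v (lat_rank L2)}"
    using E L unfolding additively_indecomposable_def by blast
  then show False
  proof
    assume "proj_image1 E (f \<circ> g) L1 = {0\<^sub>v (lat_rank L1)}"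
    then have "vec_first (f (g x)) (lat_rank L1) = 0\<^sub>v (lat_rank L1)" if "x \<in> carrier_vec n" for x
      using that rank unfolding proj_image1_def lat_vecs_def n_def by (metis (no_types, lifting) comp_apply imageI singletonD)
    from kill[OF linear_map_vec_first this] have "proj_image1 l f L1 = {0\<^sub>v (lat_rank L1)}"
      using ne unfolding proj_image1_def lat_vecs_def n_def by auto
    with p1 show False ..
  next
    assume "proj_image2 E (f \<circ> g) L2 = {0\<^sub>v (lat_rank L2)}"
    then have "vec_last (f (g x)) (lat_rank L2) = 0\<^sub>v (lat_rank L2)" if "x \<in> carrier_vec n" for x
      using that rank unfolding proj_image2_def lat_vecs_def n_def by (metis (no_types, lifting) comp_apply imageI singletonD)
    from kill[OF linear_map_vec_last this] have "proj_image2 l f L2 = {0\<^sub>v (lat_rank L2)}"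
      using ne unfolding proj_image2_def lat_vecs_def n_def by auto
    with p2 show False ..
  qed
qed

definition gram_mat :: "nat \<Rightarrow> (nat \<Rightarrow> nat \<Rightarrow> int) \<Rightarrow> int mat" where
  "gram_mat n g = mat n n (\<lambda>(i, j). g i j)"

lemma gram_mat_carrier [simp]: "gram_mat n g \<in> carrier_mat n n" "lat_rank (gram_mat n g) = n"
  unfolding gram_mat_def by auto

lemma lat_form_gram_mat:
  assumes "x \<in> carrier_vec n" "y \<in> carrier_vec n"
  shows "lat_form (gram_mat n g) x y = bilin {0..<n} g (\<lambda>i. x $ i) (\<lambda>i. y $ i)"
  unfolding lat_form_bilin[OF gram_mat_carrier(1) assms]
  by (rule bilin_cong) (auto simp: gram_mat_def)

lemma is_lattice_gram_mat:
  assumes "sym_form g" "pos_def_on {0..<n} g"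
  shows "is_lattice (gram_mat n g)"
proof -
  have "0 < lat_form (gram_mat n g) x x" if x: "x \<in> carrier_vec n" "x \<noteq> 0\<^sub>v n" for x
  proof -
    have "\<exists>i<n. x $ i \<noteq> 0"
      using x by (metis carrier_vecD eq_vecI index_zero_vec(1) index_zero_vec(2))
    then have "\<exists>i\<in>{0..<n}. x $ i \<noteq> 0" by auto
    then show ?thesis
      using assms(2) unfolding lat_form_gram_mat[OF x(1) x(1)] pos_def_on_def by blast
  qed
  moreover have "transpose_mat (gram_mat n g) = gram_mat n g"
    using assms(1) unfolding gram_mat_def sym_form_def by (intro eq_matI) auto
  moreover have "square_mat (gram_mat n g)" unfolding gram_mat_def by simp
  ultimately show ?thesis unfolding is_lattice_def lat_vecs_def by auto
qed

lemma lattice_eq_gram_mat: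
  assumes "is_lattice G" "lat_rank G = n"
  shows "\<exists>g. sym_form g \<and> pos_def_on {0..<n} g \<and> G = gram_mat n g"
proof -
  define g where "g i j = (if i < n \<and> j < n then G $$ (i, j) else 0)" for i j
  have G: "G \<in> carrier_mat n n" using is_lattice_carrier[OF assms(1)] unfolding assms(2) .
  have eq: "G = gram_mat n g" unfolding gram_mat_def g_def using G by (intro eq_matI) auto
  have "sym_form g"
    unfolding sym_form_def
  proof (intro allI)
    fix a b
    have "G $$ (a, b) = G $$ (b, a)" if "a < n" "b < n"
      using assms(1) that G unfolding is_lattice_def by (metis carrier_matD index_transpose_mat(1))
    then show "g a b = g b a" unfolding g_def by auto
  qed
  moreover have "pos_def_on {0..<n} g"
    unfolding pos_def_on_def
  proof (intro allI impI)
    fix x :: "nat \<Rightarrow> int" assume x: "\<exists>a\<in>{0..<n}. x a \<noteq> 0"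
    then obtain a where "a < n" "x a \<noteq> 0" by auto
    then have "vec n x $ a \<noteq> 0\<^sub>v n $ a" by simp
    then have "vec n x \<noteq> 0\<^sub>v n" by metis
    then have "0 < lat_form G (vec n x) (vec n x)"
      using assms unfolding is_lattice_def lat_vecs_def by auto
    also have "\<dots> = bilin {0..<n} g x x"
      unfolding eq by (subst lat_form_gram_mat) (auto intro!: bilin_cong)
    finally show "0 < bilin {0..<n} g x x" .
  qed
  ultimately show ?thesis using eq by blast
qed

lemma represents_shear:
  assumes ij: "i \<in> {0..<n}" "j \<in> {0..<n}" "i \<noteq> j" and g: "sym_form g" "pos_def_on {0..<n} g"
  shows "represents (gram_mat n g) (gram_mat n (shear i j k g))"
proof (rule represents_of_realizes)
  show "is_lattice (gram_mat n (shear i j k g))" "is_lattice (gram_mat n g)"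
    using is_lattice_gram_mat sym_form_shear pos_def_on_shear assms by simp_all
  let ?f = "\<lambda>x. vec n ((\<lambda>a. x $ a)(i := x $ i + k * x $ j))"
  have "linear_map n n ?f" unfolding linear_map_def using ij by (auto intro!: eq_vecI simp: algebra_simps)
  moreover have "lat_form (gram_mat n g) (?f x) (?f y) = lat_form (gram_mat n (shear i j k g)) x y"
    if "x \<in> carrier_vec n" "y \<in> carrier_vec n" for x y
    unfolding lat_form_gram_mat[OF that]
    unfolding bilin_shear[OF finite_atLeastLessThan ij]
    by (subst lat_form_gram_mat) (auto intro!: bilin_cong)
  ultimately show "realizes (gram_mat n g) n (lat_form (gram_mat n (shear i j k g)))"
    unfolding realizes_def by auto
qed simp

lemma represents_refl: "represents L L"
proof -
  have "is_representation L L id" unfolding is_representation_def by auto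
  then show ?thesis unfolding represents_def by blast
qed

lemma shear_equiv_represents:
  assumes "shear_equiv {0..<n} g h" "sym_form g" "pos_def_on {0..<n} g"
  shows "represents (gram_mat n g) (gram_mat n h) \<and> represents (gram_mat n h) (gram_mat n g)"
  using assms
proof induction
  case (unchanged g)
  then show ?case using represents_refl by blast
next
  case (sheared g h i j k)
  have h: "sym_form h" "pos_def_on {0..<n} h"
    using shear_equiv_preserves[OF sheared.hyps(1)] sheared.prems by auto
  have "represents (gram_mat n h) (gram_mat n (shear i j k h))"
    using represents_shear sheared.hyps h by blast
  moreover have "represents (gram_mat n (shear i j k h)) (gram_mat n h)"
    using represents_shear[of i n j "shear i j k h" "- k"] sheared.hyps h
    by (simp add: shear_inverse sym_form_shear pos_def_on_shear)
  ultimately show ?case using sheared represents_trans by blast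
qed

section \<open>A lattice that avoids an indecomposable one\<close>

lemma bilin_rank_one_sum:
  fixes V :: "(nat \<Rightarrow> int) set"
  assumes "\<And>i j. i \<in> I \<Longrightarrow> j \<in> I \<Longrightarrow> g i j = (\<Sum>v\<in>V. w v * of_int (v i) * of_int (v j))"
  shows "bilin I g x y = (\<Sum>v\<in>V. w v * (\<Sum>i\<in>I. of_int (v i) * x i) * (\<Sum>i\<in>I. of_int (v i) * y i))"
proof -
  have "bilin I g x y = (\<Sum>a\<in>I. \<Sum>b\<in>I. \<Sum>v\<in>V. w v * (of_int (v a) * x a) * (of_int (v b) * y b))"
    unfolding bilin_def using assms by (auto simp: sum_distrib_left mult_ac intro!: sum.cong)
  also have "\<dots> = (\<Sum>a\<in>I. \<Sum>v\<in>V. \<Sum>b\<in>I. w v * (of_int (v a) * x a) * (of_int (v b) * y b))"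
    by (intro sum.cong[OF refl] sum.swap)
  also have "\<dots> = (\<Sum>v\<in>V. \<Sum>a\<in>I. \<Sum>b\<in>I. w v * (of_int (v a) * x a) * (of_int (v b) * y b))"
    by (rule sum.swap)
  also have "\<dots> = (\<Sum>v\<in>V. w v * (\<Sum>i\<in>I. of_int (v i) * x i) * (\<Sum>i\<in>I. of_int (v i) * y i))"
  proof (rule sum.cong[OF refl])
    fix v
    have "(\<Sum>a\<in>I. \<Sum>b\<in>I. w v * (of_int (v a) * x a) * (of_int (v b) * y b)) =
        w v * (\<Sum>a\<in>I. \<Sum>b\<in>I. (of_int (v a) * x a) * (of_int (v b) * y b))"
      by (simp only: sum_distrib_left mult.assoc)
    also have "\<dots> = w v * (\<Sum>i\<in>I. of_int (v i) * x i) * (\<Sum>i\<in>I. of_int (v i) * y i)"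
      by (simp only: sum_product mult.assoc)
    finally show "(\<Sum>a\<in>I. \<Sum>b\<in>I. w v * (of_int (v a) * x a) * (of_int (v b) * y b)) = \<dots>" .
  qed
  finally show ?thesis .
qed

lemma bilin_of_int:
  "real_of_int (bilin I g x y) = bilin I (\<lambda>i j. real_of_int (g i j)) (\<lambda>i. real_of_int (x i)) (\<lambda>i. real_of_int (y i))"
  unfolding bilin_def by simp

text \<open>
  A nonnegative combination of forms \<open>v v\<^sup>T\<close> vanishes at \<open>x\<close> only if \<open>x\<close> is orthogonal to each \<open>v\<close> of positive
  weight. So only the support of the weights matters for definiteness.
\<close>
lemma pos_def_on_of_weights:
  fixes V :: "(nat \<Rightarrow> int) set"
  assumes V: "finite V"
    and g: "\<And>i j. i \<in> I \<Longrightarrow> j \<in> I \<Longrightarrow> real_of_int (g i j) = (\<Sum>v\<in>V. l v * real_of_int (v i) * real_of_int (v j))"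
    and q: "\<And>i j. i \<in> I \<Longrightarrow> j \<in> I \<Longrightarrow> real_of_int (q i j) = (\<Sum>v\<in>V. r v * real_of_int (v i) * real_of_int (v j))"
    and r: "\<And>v. 0 \<le> r v" "\<And>v. 0 < l v \<Longrightarrow> 0 < r v"
    and pd: "pos_def_on I g"
  shows "pos_def_on I q"
  unfolding pos_def_on_def
proof (intro allI impI)
  fix x :: "nat \<Rightarrow> int" assume "\<exists>a\<in>I. x a \<noteq> 0"
  then have "0 < bilin I g x x" using pd unfolding pos_def_on_def by blast
  then have pos: "0 < real_of_int (bilin I g x x)" by simp
  let ?s = "\<lambda>v::nat \<Rightarrow> int. (\<Sum>i\<in>I. real_of_int (v i) * real_of_int (x i))"
  have "real_of_int (bilin I g x x) = (\<Sum>v\<in>V. l v * ?s v * ?s v)"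
    unfolding bilin_of_int by (rule bilin_rank_one_sum[OF g])
  then have "\<exists>v\<in>V. 0 < l v * ?s v * ?s v"
    using pos by (metis (no_types, lifting) linorder_not_less sum_nonpos)
  then obtain v where v: "v \<in> V" "0 < l v * (?s v * ?s v)" by (auto simp: mult.assoc)
  have "0 \<le> ?s v * ?s v" by simp
  then have "0 < l v" "0 < ?s v * ?s v" using v(2) by (simp_all only: zero_less_mult_iff[of "l v"]) linarith+
  then have "0 < r v * ?s v * ?s v" using r(2)[of v] by (simp add: mult.assoc)
  also have "\<dots> \<le> (\<Sum>v\<in>V. r v * ?s v * ?s v)"
    using v(1) V r(1) by (intro member_le_sum) (auto simp: mult.assoc)
  also have "\<dots> = real_of_int (bilin I q x x)"
    unfolding bilin_of_int by (rule bilin_rank_one_sum[OF q, symmetric])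
  finally show "0 < bilin I q x x" by simp
qed

lemma realizes_scaled_square:
  "realizes (gram_mat 1 (\<lambda>i j. c)) n (\<lambda>x y. c * (\<Sum>i\<in>{0..<n}. w i * x $ i) * (\<Sum>i\<in>{0..<n}. w i * y $ i))"
proof -
  let ?f = "\<lambda>x :: int vec. vec 1 (\<lambda>_. \<Sum>i\<in>{0..<n}. w i * x $ i)"
  have "linear_map n 1 ?f"
    unfolding linear_map_def by (auto intro!: eq_vecI sum.cong simp: sum.distrib[symmetric] sum_distrib_left algebra_simps)
  moreover have "lat_form (gram_mat 1 (\<lambda>i j. c)) (?f x) (?f y) = c * (\<Sum>i\<in>{0..<n}. w i * x $ i) * (\<Sum>i\<in>{0..<n}. w i * y $ i)" for x y
    by (subst lat_form_gram_mat) (auto simp: bilin_def)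
  ultimately show ?thesis unfolding realizes_def by auto
qed

lemma is_lattice_rank_one: "0 < c \<Longrightarrow> is_lattice (gram_mat 1 (\<lambda>i j. c))"
  by (rule is_lattice_gram_mat) (auto simp: sym_form_def pos_def_on_def bilin_def mult.assoc zero_less_mult_iff linorder_neq_iff)

text \<open>
  The diagonal map embeds \<open>\<langle>2\<rangle>\<close> into \<open>\<langle>1\<rangle> \<bottom> \<langle>1\<rangle>\<close>, and neither projection kills a nonzero vector of it.
\<close>
lemma two_not_represents:
  assumes E: "additively_indecomposable E" "0 < lat_rank E"
  shows "\<not> represents (gram_mat 1 (\<lambda>i j. 2)) E"
proof
  let ?one = "gram_mat 1 (\<lambda>i j. 1)"
  assume "represents (gram_mat 1 (\<lambda>i j. 2)) E"
  then obtain f where f: "is_representation E (gram_mat 1 (\<lambda>i j. 2)) f" unfolding represents_def by blast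
  define n where "n = lat_rank E"
  have lin: "linear_map n 1 f" using representation_linear[OF f] n_def by simp
  have fc: "f x \<in> carrier_vec 1" if "x \<in> carrier_vec n" for x
    using lin that unfolding linear_map_def by blast
  have one: "is_lattice ?one" by (rule is_lattice_rank_one) simp
  have double: "lat_form (orth_sum ?one ?one) (a @\<^sub>v a) (b @\<^sub>v b) = lat_form (gram_mat 1 (\<lambda>i j. 2)) a b"
    if "a \<in> carrier_vec 1" "b \<in> carrier_vec 1" for a b
    using lat_form_orth_sum[OF one one, of a b a b] that
    by (simp add: lat_vecs_def lat_form_gram_mat bilin_def)
  have "is_representation E (orth_sum ?one ?one) (\<lambda>x. f x @\<^sub>v f x)"
    unfolding is_representation_def
  proof (intro conjI ballI allI)
    show "(\<lambda>x. f x @\<^sub>v f x) ` lat_vecs E \<subseteq> lat_vecs (orth_sum ?one ?one)"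
    proof (rule image_subsetI)
      fix x assume "x \<in> lat_vecs E"
      then have "f x \<in> carrier_vec 1" using fc unfolding lat_vecs_def n_def by blast
      then have "f x @\<^sub>v f x \<in> carrier_vec (1 + 1)" by (intro append_carrier_vec)
      then show "f x @\<^sub>v f x \<in> lat_vecs (orth_sum ?one ?one)" unfolding lat_vecs_def by simp
    qed
  next
    fix x y assume "x \<in> lat_vecs E" "y \<in> lat_vecs E"
    then have xy: "x \<in> carrier_vec n" "y \<in> carrier_vec n" unfolding lat_vecs_def n_def by auto
    have "f (x + y) = f x + f y" using lin xy unfolding linear_map_def by blast
    then show "f (x + y) @\<^sub>v f (x + y) = (f x @\<^sub>v f x) + (f y @\<^sub>v f y)"
      using append_vec_add[OF fc[OF xy(1)] fc[OF xy(2)] fc[OF xy(1)] fc[OF xy(2)]] by simp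
  next
    fix c x assume "x \<in> lat_vecs E"
    then have x: "x \<in> carrier_vec n" unfolding lat_vecs_def n_def by auto
    have "f (c \<cdot>\<^sub>v x) = c \<cdot>\<^sub>v f x" using lin x unfolding linear_map_def by blast
    then show "f (c \<cdot>\<^sub>v x) @\<^sub>v f (c \<cdot>\<^sub>v x) = c \<cdot>\<^sub>v (f x @\<^sub>v f x)"
      by (intro eq_vecI) auto
  next
    show "inj_on (\<lambda>x. f x @\<^sub>v f x) (lat_vecs E)"
    proof (rule inj_onI)
      fix x y assume xy: "x \<in> lat_vecs E" "y \<in> lat_vecs E" "f x @\<^sub>v f x = f y @\<^sub>v f y"
      then have "vec_first (f x @\<^sub>v f x) 1 = vec_first (f y @\<^sub>v f y) 1" by simp
      moreover have "f x \<in> carrier_vec 1" "f y \<in> carrier_vec 1"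
        using xy fc unfolding lat_vecs_def n_def by blast+
      ultimately have "f x = f y" by (simp only: vec_first_append)
      then show "x = y" using f xy unfolding is_representation_def inj_on_def by blast
    qed
  next
    fix x y assume xy: "x \<in> lat_vecs E" "y \<in> lat_vecs E"
    then show "lat_form (orth_sum ?one ?one) (f x @\<^sub>v f x) (f y @\<^sub>v f y) = lat_form E x y"
      using double[of "f x" "f y"] fc f unfolding is_representation_def lat_vecs_def n_def by simp
  qed
  then have "proj_image1 E (\<lambda>x. f x @\<^sub>v f x) ?one = {0\<^sub>v 1} \<or> proj_image2 E (\<lambda>x. f x @\<^sub>v f x) ?one = {0\<^sub>v 1}"
    using E(1) one unfolding additively_indecomposable_def by fastforce
  then have "vec_first (f x @\<^sub>v f x) 1 = 0\<^sub>v 1 \<or> vec_last (f x @\<^sub>v f x) 1 = 0\<^sub>v 1" if "x \<in> carrier_vec n" for x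
    using that unfolding proj_image1_def proj_image2_def lat_vecs_def n_def by auto
  then have zero: "f x = 0\<^sub>v 1" if "x \<in> carrier_vec n" for x
    using that fc by simp
  have u: "unit_vec n 0 \<in> carrier_vec n" "0\<^sub>v n \<in> carrier_vec n" by auto
  then have "f (unit_vec n 0) = f (0\<^sub>v n)" using zero by simp
  then have "unit_vec n 0 = (0\<^sub>v n :: int vec)"
    using f u unfolding is_representation_def inj_on_def lat_vecs_def n_def by blast
  then have "unit_vec n 0 $ 0 = (0\<^sub>v n :: int vec) $ 0" by simp
  then show False using E(2) n_def by simp
qed

text \<open>
  The map \<open>x \<mapsto> (v \<cdot> x, x)\<close> into \<open>\<langle>1\<rangle> \<bottom> Q\<close> shows that \<open>v v\<^sup>T + Q\<close> is decomposable.
\<close>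
lemma square_split_not_represents:
  assumes E: "additively_indecomposable E" "lat_rank E = n" "0 < n"
    and R: "is_lattice (gram_mat n R)" and Q: "is_lattice (gram_mat n Q)"
    and v: "i0 < n" "v i0 \<noteq> 0"
    and eq: "\<And>i j. i < n \<Longrightarrow> j < n \<Longrightarrow> R i j = v i * v j + Q i j"
  shows "\<not> represents (gram_mat n R) E"
proof -
  let ?one = "gram_mat 1 (\<lambda>i j. 1)"
  have one: "is_lattice ?one" by (rule is_lattice_rank_one) simp
  define h where "h x = (\<Sum>i\<in>{0..<n}. v i * x $ i)" for x :: "int vec"
  define f where "f x = vec 1 (\<lambda>_. h x) @\<^sub>v x" for x :: "int vec"
  have h_lin: "h (x + y) = h x + h y" "h (c \<cdot>\<^sub>v x) = c * h x"
    if "x \<in> carrier_vec n" "y \<in> carrier_vec n" for x y c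
    using that unfolding h_def by (auto simp: sum.distrib[symmetric] sum_distrib_left algebra_simps intro!: sum.cong)
  have "is_representation (gram_mat n R) (orth_sum ?one (gram_mat n Q)) f"
    unfolding is_representation_def
  proof (intro conjI ballI allI)
    show "f ` lat_vecs (gram_mat n R) \<subseteq> lat_vecs (orth_sum ?one (gram_mat n Q))"
    proof (rule image_subsetI)
      fix x assume "x \<in> lat_vecs (gram_mat n R)"
      then have "f x \<in> carrier_vec (1 + n)"
        unfolding f_def lat_vecs_def by (intro append_carrier_vec) auto
      then show "f x \<in> lat_vecs (orth_sum ?one (gram_mat n Q))" unfolding lat_vecs_def by simp
    qed
  next
    fix x y assume "x \<in> lat_vecs (gram_mat n R)" "y \<in> lat_vecs (gram_mat n R)"
    then have xy: "x \<in> carrier_vec n" "y \<in> carrier_vec n" unfolding lat_vecs_def by auto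
    have "vec 1 (\<lambda>_. h (x + y)) = vec 1 (\<lambda>_. h x) + vec 1 (\<lambda>_. h y)"
      using h_lin(1)[OF xy] by (intro eq_vecI) auto
    then show "f (x + y) = f x + f y"
      unfolding f_def using append_vec_add[OF vec_carrier vec_carrier xy] by metis
    have "lat_form (orth_sum ?one (gram_mat n Q)) (f x) (f y) = h x * h y + lat_form (gram_mat n Q) x y"
      unfolding f_def using lat_form_orth_sum[OF one Q, of "vec 1 (\<lambda>_. h x)" "vec 1 (\<lambda>_. h y)" x y] xy
      by (simp add: lat_vecs_def lat_form_gram_mat bilin_def)
    also have "\<dots> = bilin {0..<n} (\<lambda>i j. v i * v j + Q i j) (\<lambda>i. x $ i) (\<lambda>i. y $ i)"
      unfolding lat_form_gram_mat[OF xy] bilin_add bilin_rank_one h_def ..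
    also have "\<dots> = lat_form (gram_mat n R) x y"
      unfolding lat_form_gram_mat[OF xy] by (rule bilin_cong) (auto simp: eq)
    finally show "lat_form (orth_sum ?one (gram_mat n Q)) (f x) (f y) = lat_form (gram_mat n R) x y" .
  next
    fix c x assume "x \<in> lat_vecs (gram_mat n R)"
    then have x: "x \<in> carrier_vec n" unfolding lat_vecs_def by auto
    then show "f (c \<cdot>\<^sub>v x) = c \<cdot>\<^sub>v f x"
      unfolding f_def h_lin(2)[OF x x] by (intro eq_vecI) auto
  next
    show "inj_on f (lat_vecs (gram_mat n R))"
    proof (rule inj_onI)
      fix x y assume xy: "x \<in> lat_vecs (gram_mat n R)" "y \<in> lat_vecs (gram_mat n R)" "f x = f y"
      then have "vec_last (f x) n = vec_last (f y) n" by simp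
      then show "x = y" using xy unfolding f_def lat_vecs_def by simp
    qed
  qed
  moreover have "proj_image1 (gram_mat n R) f ?one \<noteq> {0\<^sub>v (lat_rank ?one)}"
  proof
    assume "proj_image1 (gram_mat n R) f ?one = {0\<^sub>v (lat_rank ?one)}"
    then have "vec_first (f (unit_vec n i0)) 1 = 0\<^sub>v 1"
      unfolding proj_image1_def lat_vecs_def by (auto simp: image_subset_iff dest!: equalityD1)
    then have "vec 1 (\<lambda>_. h (unit_vec n i0)) = 0\<^sub>v 1" unfolding f_def by simp
    then have "vec 1 (\<lambda>_. h (unit_vec n i0)) $ 0 = 0\<^sub>v 1 $ 0" by metis
    then have "h (unit_vec n i0) = 0" by simp
    moreover have "h (unit_vec n i0) = (\<Sum>i\<in>{0..<n}. if i = i0 then v i else 0)"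
      unfolding h_def by (intro sum.cong) (use v(1) in auto)
    ultimately show False using v by simp
  qed
  moreover have "proj_image2 (gram_mat n R) f (gram_mat n Q) \<noteq> {0\<^sub>v (lat_rank (gram_mat n Q))}"
  proof
    assume "proj_image2 (gram_mat n R) f (gram_mat n Q) = {0\<^sub>v (lat_rank (gram_mat n Q))}"
    then have "vec_last (f (unit_vec n 0)) n = 0\<^sub>v n"
      unfolding proj_image2_def lat_vecs_def by (auto simp: image_subset_iff dest!: equalityD1)
    then have "unit_vec n 0 = (0\<^sub>v n :: int vec)" unfolding f_def by simp
    then have "unit_vec n 0 $ 0 = (0\<^sub>v n :: int vec) $ 0" by metis
    then show False using E(3) by simp
  qed
  ultimately show ?thesis
    using decomposable_not_represents[OF E(1) _ one Q] E(2) by simp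
qed

text \<open>
  The lattice is the sum of \<open>L1\<close>, made of four copies of \<open>\<langle>2\<rangle>\<close> for each direction of the cone, and of \<open>L2\<close>,
  the sum of all lattices with entries bounded by \<open>B\<close> that do not represent \<open>E\<close>. For a given \<open>l\<close> the first
  summand absorbs the large even parts of the cone coefficients of a reduced form of \<open>l\<close>, and the
  remainder is one of the summands of \<open>L2\<close>.
\<close>
theorem ex_lattice_avoiding:
  assumes E: "is_lattice E" "additively_indecomposable E" "lat_rank E = n" "0 < n"
  shows "\<exists>L. is_lattice L \<and> \<not> represents L E \<and>
    (\<forall>l. is_lattice l \<and> lat_rank l = n \<and> \<not> represents l E \<longrightarrow> represents L l)"
proof -
  let ?I = "{0..<n}" and ?two = "gram_mat 1 (\<lambda>i j. 2) :: int mat"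
  obtain c C where cC: "0 < c" "0 < C" and red: "\<forall>g. sym_form g \<longrightarrow> pos_def_on ?I g \<longrightarrow>
    (\<exists>g'. shear_equiv ?I g g' \<and> reduced_form 0 n c C (\<lambda>i j. real_of_int (g' i j)))"
    using ex_reduced_form[of 0 n] by blast
  obtain K where K: "\<And>g. reduced_form 0 n c C g \<Longrightarrow> g \<in> rank_one_cone 0 n K"
    using reduced_form_in_cone[OF _ cC, of 0 n] by blast
  define V where "V = int_box 0 n K"
  have V: "finite V" unfolding V_def by (rule finite_int_box)
  define B where "B = 4 * (int K)\<^sup>2 * int (card V)"
  define Rs where "Rs = {R \<in> (\<lambda>f. mat n n f) ` (({0..<n} \<times> {0..<n}) \<rightarrow>\<^sub>E {-B..B}). is_lattice R \<and> \<not> represents R E}"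
  have "finite (({0..<n} \<times> {0..<n}) \<rightarrow>\<^sub>E {-B..B})"
    by (rule finite_PiE) simp_all
  then have "finite ((\<lambda>f. mat n n f) ` (({0..<n} \<times> {0..<n}) \<rightarrow>\<^sub>E {-B..B}))"
    by (rule finite_imageI)
  then have Rs: "finite Rs" unfolding Rs_def by (rule finite_subset[rotated]) blast
  have two: "is_lattice ?two" by (rule is_lattice_rank_one) simp
  have "finite (V \<times> {0..<4::nat})" using V by simp
  from ex_orthogonal_sum_of_family[OF this, of "\<lambda>_. ?two", OF two]
  obtain L1 where L1: "is_lattice L1"
      "\<forall>E. is_lattice E \<and> additively_indecomposable E \<and> 0 < lat_rank E \<and> represents L1 E \<longrightarrow>
        (\<exists>k\<in>V \<times> {0..<4::nat}. represents ?two E)"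
      "\<forall>n \<beta>. (\<forall>k\<in>V \<times> {0..<4::nat}. realizes ?two n (\<beta> k)) \<longrightarrow>
        realizes L1 n (\<lambda>x y. \<Sum>k\<in>V \<times> {0..<4}. \<beta> k x y)"
    by blast
  have "is_lattice R" if "R \<in> Rs" for R using that unfolding Rs_def by blast
  from ex_orthogonal_sum_of_family[OF Rs, of "\<lambda>R. R", OF this]
  obtain L2 where L2: "is_lattice L2"
      "\<forall>E. is_lattice E \<and> additively_indecomposable E \<and> 0 < lat_rank E \<and> represents L2 E \<longrightarrow>
        (\<exists>R\<in>Rs. represents R E)"
      "\<forall>n \<beta>. (\<forall>R\<in>Rs. realizes R n (\<beta> R)) \<longrightarrow> realizes L2 n (\<lambda>x y. \<Sum>R\<in>Rs. \<beta> R x y)"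
    by blast
  have "\<not> represents L1 E"
    using L1(2) E two_not_represents[OF E(2)] by blast
  moreover have "\<not> represents L2 E"
    using L2(2) E unfolding Rs_def by blast
  ultimately have "\<not> represents (orth_sum L1 L2) E"
    using indecomposable_orth_sum[OF E(2) L1(1) L2(1) E(1)] by blast
  moreover
  have "represents (orth_sum L1 L2) l" if l: "is_lattice l" "lat_rank l = n" "\<not> represents l E" for l
  proof -
    obtain g where g: "sym_form g" "pos_def_on ?I g" "l = gram_mat n g"
      using lattice_eq_gram_mat[OF l(1,2)] by blast
    obtain g' where g': "shear_equiv ?I g g'" "reduced_form 0 n c C (\<lambda>i j. real_of_int (g' i j))"
      using red g by blast
    have rep: "represents l (gram_mat n g')" "represents (gram_mat n g') l"
      using shear_equiv_represents[OF g'(1) g(1,2)] g(3) by auto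
    have g'': "sym_form g'" "pos_def_on ?I g'"
      using shear_equiv_preserves[OF g'(1)] g by auto
    from K[OF g'(2)] obtain w where w: "\<forall>v. 0 \<le> w v"
        "\<forall>i\<in>?I. \<forall>j\<in>?I. real_of_int (g' i j) = (\<Sum>v\<in>V. w v * real_of_int (v i) * real_of_int (v j))"
      unfolding rank_one_cone_def V_def by blast
    \<comment> \<open>One less than the largest possible value: then \<open>b v \<noteq> 0\<close> leaves \<open>r v \<ge> 2\<close>, so that \<open>v v\<^sup>T\<close> can be
      split off the remainder without changing its support. The subtraction is truncated at \<open>0\<close>.\<close>
    define b where "b v = nat \<lfloor>w v / 2\<rfloor> - 1" for v
    define r where "r v = w v - 2 * real (b v)" for v
    have r: "0 \<le> r v" "r v \<le> 4" "0 < w v \<Longrightarrow> 0 < r v" "b v \<noteq> 0 \<Longrightarrow> 2 \<le> r v" for v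
    proof -
      define q where "q = \<lfloor>w v / 2\<rfloor>"
      have q: "real_of_int q \<le> w v / 2" "w v / 2 < real_of_int q + 1" "0 \<le> q"
        using w(1) unfolding q_def by (simp_all, linarith)
      have "r v = (if q = 0 then w v else w v - 2 * real_of_int q + 2)" "b v \<noteq> 0 \<Longrightarrow> q \<noteq> 0"
        using q(3) unfolding r_def b_def q_def[symmetric] by (auto simp: of_nat_diff)
      then show "0 \<le> r v" "r v \<le> 4" "0 < w v \<Longrightarrow> 0 < r v" "b v \<noteq> 0 \<Longrightarrow> 2 \<le> r v"
        using q w(1) by (auto split: if_splits)
    qed
    define R where "R i j = g' i j - (\<Sum>v\<in>V. 2 * int (b v) * v i * v j)" for i j
    have R: "real_of_int (R i j) = (\<Sum>v\<in>V. r v * real_of_int (v i) * real_of_int (v j))"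
      if "i \<in> ?I" "j \<in> ?I" for i j
      unfolding R_def r_def using w(2) that by (simp add: sum_subtractf left_diff_distrib)
    have symR: "sym_form R" using g''(1) unfolding sym_form_def R_def by (simp add: mult_ac)
    have pdR: "pos_def_on ?I R"
      by (rule pos_def_on_of_weights[OF V _ R r(1) r(3) g''(2)]) (use w(2) in auto)
    have latR: "is_lattice (gram_mat n R)" using is_lattice_gram_mat[OF symR pdR] .
    have bound: "\<bar>R i j\<bar> \<le> B" if "i \<in> ?I" "j \<in> ?I" for i j
    proof -
      have "\<bar>real_of_int (R i j)\<bar> \<le> (\<Sum>v\<in>V. \<bar>r v * real_of_int (v i) * real_of_int (v j)\<bar>)"
        unfolding R[OF that] by (rule sum_abs)
      also have "\<dots> \<le> (\<Sum>v\<in>V. 4 * real K * real K)"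
      proof (rule sum_mono)
        fix v assume "v \<in> V"
        then have "\<bar>v i\<bar> \<le> int K" "\<bar>v j\<bar> \<le> int K" using that unfolding V_def int_box_def by auto
        then have "real_of_int \<bar>v i\<bar> \<le> real K" "real_of_int \<bar>v j\<bar> \<le> real K" by linarith+
        then have "\<bar>r v\<bar> * \<bar>real_of_int (v i)\<bar> * \<bar>real_of_int (v j)\<bar> \<le> 4 * real K * real K"
          using r(1,2)[of v] by (intro mult_mono) auto
        then show "\<bar>r v * real_of_int (v i) * real_of_int (v j)\<bar> \<le> 4 * real K * real K"
          by (simp add: abs_mult)
      qed
      also have "\<dots> = real_of_int B" unfolding B_def by (simp add: power2_eq_square)
      finally show ?thesis by linarith
    qed
    have notR: "\<not> represents (gram_mat n R) E"
    proof (cases "\<exists>v\<in>V. b v \<noteq> 0 \<and> (\<exists>i<n. v i \<noteq> 0)")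
      case True
      then obtain v0 i0 where v0: "v0 \<in> V" "b v0 \<noteq> 0" "i0 < n" "v0 i0 \<noteq> 0" by blast
      \<comment> \<open>the weight of \<open>v0\<close> drops by 1 and stays positive\<close>
      define Q where "Q i j = R i j - v0 i * v0 j" for i j
      have "pos_def_on ?I Q"
      proof (rule pos_def_on_of_weights[OF V _ _ _ _ g''(2), of w _ "\<lambda>v. r v - (if v = v0 then 1 else 0)"])
        fix i j assume ij: "i \<in> ?I" "j \<in> ?I"
        have "(\<Sum>v\<in>V. (r v - (if v = v0 then 1 else 0)) * real_of_int (v i) * real_of_int (v j)) =
          (\<Sum>v\<in>V. r v * real_of_int (v i) * real_of_int (v j)) - (\<Sum>v\<in>V. if v = v0 then real_of_int (v i) * real_of_int (v j) else 0)"
          unfolding sum_subtractf[symmetric] by (intro sum.cong) (auto simp: left_diff_distrib)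
        also have "\<dots> = real_of_int (R i j) - real_of_int (v0 i) * real_of_int (v0 j)"
          using R[OF ij] v0(1) V by simp
        finally show "real_of_int (Q i j) = (\<Sum>v\<in>V. (r v - (if v = v0 then 1 else 0)) * real_of_int (v i) * real_of_int (v j))"
          unfolding Q_def by simp
      next
        fix v
        show "0 \<le> r v - (if v = v0 then 1 else 0)" using r(1)[of v] r(4)[OF v0(2)] by auto
        show "0 < r v - (if v = v0 then 1 else 0)" if "0 < w v" using r(3)[OF that] r(4)[OF v0(2)] by auto
      qed (use w(2) in auto)
      moreover have "sym_form Q" using symR unfolding sym_form_def Q_def by (simp add: mult.commute)
      ultimately have "is_lattice (gram_mat n Q)" using is_lattice_gram_mat by blast
      then show ?thesis
        using square_split_not_represents[OF E(2,3,4) latR, of Q i0 v0] v0 unfolding Q_def by simp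
    next
      case False
      have "R i j = g' i j" if "i < n" "j < n" for i j
      proof -
        have "(\<Sum>v\<in>V. 2 * int (b v) * v i * v j) = 0"
          using False that by (intro sum.neutral) auto
        then show ?thesis unfolding R_def by simp
      qed
      then have "gram_mat n R = gram_mat n g'" unfolding gram_mat_def by (intro eq_matI) auto
      then show ?thesis using rep(1) l(3) represents_trans by metis
    qed
    have RRs: "gram_mat n R \<in> Rs"
    proof -
      have "gram_mat n R = mat n n (restrict (\<lambda>(i, j). R i j) (?I \<times> ?I))"
        unfolding gram_mat_def by (intro eq_matI) auto
      moreover have "restrict (\<lambda>(i, j). R i j) (?I \<times> ?I) \<in> (?I \<times> ?I) \<rightarrow>\<^sub>E {-B..B}"
      proof (rule PiE_I)
        fix p assume p: "p \<in> ?I \<times> ?I"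
        then have "\<bar>R (fst p) (snd p)\<bar> \<le> B" by (intro bound) auto
        then show "restrict (\<lambda>(i, j). R i j) (?I \<times> ?I) p \<in> {-B..B}"
          using p by (auto simp: case_prod_beta abs_le_iff)
      qed simp
      ultimately have "gram_mat n R \<in> (\<lambda>f. mat n n f) ` ((?I \<times> ?I) \<rightarrow>\<^sub>E {-B..B})"
        by (rule image_eqI)
      then show ?thesis unfolding Rs_def using latR notR by (intro CollectI conjI)
    qed
    have "\<forall>v. \<exists>t. int (b v) = (\<Sum>k\<in>{0..<4::nat}. (t k)\<^sup>2)"
      by (intro allI ex_four_squares_indexed)
    from choice[OF this]
    obtain s where s: "\<And>v. int (b v) = (\<Sum>k\<in>{0..<4::nat}. (s v k)\<^sup>2)" by blast
    let ?d = "\<lambda>v x. (\<Sum>i\<in>?I. v i * x $ i) :: int"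
    define \<beta> where "\<beta> = (\<lambda>(v, k) x y. 2 * (\<Sum>i\<in>?I. (s v k * v i) * x $ i) * (\<Sum>i\<in>?I. (s v k * v i) * y $ i))"
    have real1: "realizes L1 n (\<lambda>x y. \<Sum>k\<in>V \<times> {0..<4}. \<beta> k x y)"
      unfolding \<beta>_def by (rule L1(3)[rule_format], simp only: split_beta, rule realizes_scaled_square)
    have \<beta>: "(\<Sum>k\<in>V \<times> {0..<4}. \<beta> k x y) = (\<Sum>v\<in>V. 2 * int (b v) * ?d v x * ?d v y)" for x y
    proof -
      have "(\<Sum>k\<in>V \<times> {0..<4}. \<beta> k x y) = (\<Sum>v\<in>V. \<Sum>k\<in>{0..<4}. \<beta> (v, k) x y)"
        by (simp add: sum.cartesian_product)
      also have "\<dots> = (\<Sum>v\<in>V. 2 * int (b v) * ?d v x * ?d v y)"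
      proof (rule sum.cong[OF refl])
        fix v
        have "\<beta> (v, k) x y = (s v k)\<^sup>2 * (2 * ?d v x * ?d v y)" for k
          unfolding \<beta>_def by (simp add: mult.assoc sum_distrib_left[symmetric] power2_eq_square)
        then have "(\<Sum>k\<in>{0..<4}. \<beta> (v, k) x y) = int (b v) * (2 * ?d v x * ?d v y)"
          unfolding s sum_distrib_right by (intro sum.cong[OF refl])
        then show "(\<Sum>k\<in>{0..<4}. \<beta> (v, k) x y) = 2 * int (b v) * ?d v x * ?d v y"
          by simp
      qed
      finally show ?thesis .
    qed
    define \<gamma> where "\<gamma> = (\<lambda>S x y. if S = gram_mat n R then lat_form (gram_mat n R) x y else 0)"
    have "realizes S n (\<gamma> S)" if "S \<in> Rs" for S
    proof (cases "S = gram_mat n R")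
      case True
      then show ?thesis
        unfolding realizes_def \<gamma>_def by (intro exI[of _ "\<lambda>x. x"]) (auto simp: linear_map_def)
    next
      case False
      then show ?thesis
        unfolding realizes_def \<gamma>_def linear_map_def using lat_form_zero[of S]
        by (intro exI[of _ "\<lambda>x. 0\<^sub>v (lat_rank S)"]) auto
    qed
    then have real2: "realizes L2 n (\<lambda>x y. \<Sum>S\<in>Rs. \<gamma> S x y)" using L2(3) by blast
    have \<gamma>: "(\<Sum>S\<in>Rs. \<gamma> S x y) = lat_form (gram_mat n R) x y" for x y
      unfolding \<gamma>_def using Rs RRs by simp
    have "realizes (orth_sum L1 L2) n (\<lambda>x y. (\<Sum>v\<in>V. 2 * int (b v) * ?d v x * ?d v y) + lat_form (gram_mat n R) x y)"
      using realizes_orth_sum[OF L1(1) L2(1) real1 real2] unfolding \<beta> \<gamma> .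
    moreover have "(\<Sum>v\<in>V. 2 * int (b v) * ?d v x * ?d v y) + lat_form (gram_mat n R) x y = lat_form (gram_mat n g') x y"
      if xy: "x \<in> carrier_vec n" "y \<in> carrier_vec n" for x y
    proof -
      have "bilin ?I (\<lambda>i j. \<Sum>v\<in>V. 2 * int (b v) * v i * v j) (\<lambda>i. x $ i) (\<lambda>i. y $ i) = (\<Sum>v\<in>V. 2 * int (b v) * ?d v x * ?d v y)"
        using bilin_rank_one_sum[of ?I "\<lambda>i j. \<Sum>v\<in>V. 2 * int (b v) * v i * v j" "\<lambda>v. 2 * int (b v)" V "\<lambda>i. x $ i" "\<lambda>i. y $ i"]
        by simp
      moreover have "lat_form (gram_mat n g') x y =
          bilin ?I (\<lambda>i j. (\<Sum>v\<in>V. 2 * int (b v) * v i * v j) + R i j) (\<lambda>i. x $ i) (\<lambda>i. y $ i)"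
        unfolding lat_form_gram_mat[OF xy] by (rule bilin_cong) (simp_all add: R_def)
      ultimately show ?thesis
        unfolding bilin_add lat_form_gram_mat[OF xy] by simp
    qed
    ultimately have "realizes (orth_sum L1 L2) n (lat_form (gram_mat n g'))"
      unfolding realizes_def by auto
    then have "represents (orth_sum L1 L2) (gram_mat n g')"
      using represents_of_realizes is_lattice_gram_mat[OF g''] is_lattice_orth_sum[OF L1(1) L2(1)] by simp
    then show ?thesis using rep(2) represents_trans by blast
  qed
  ultimately show ?thesis using is_lattice_orth_sum[OF L1(1) L2(1)] by blast
qed

theorem proposition2:
  fixes n :: nat and S :: "int mat set"
  assumes "n > 0"
    and "indecomposables n \<noteq> {}"
    and "criterion_set n S"
  shows "\<exists>E \<in> indecomposables n. E \<in> S"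
proof (rule ccontr)
  assume none: "\<not> ?thesis"
  obtain E where E: "is_lattice E" "lat_rank E = n" "additively_indecomposable E"
    using assms(2) unfolding indecomposables_def by blast
  obtain L where L: "is_lattice L" "\<not> represents L E"
      "\<And>l. is_lattice l \<Longrightarrow> lat_rank l = n \<Longrightarrow> \<not> represents l E \<Longrightarrow> represents L l"
    using ex_lattice_avoiding[OF E(1,3,2) assms(1)] by blast
  have "represents L l" if "l \<in> S" for l
  proof -
    have l: "is_lattice l" "lat_rank l = n"
      using assms(3) that unfolding criterion_set_def by auto
    then have "\<not> additively_indecomposable l"
      using none that unfolding indecomposables_def by blast
    then obtain L1 L2 f where "is_lattice L1" "is_lattice L2" "is_representation l (orth_sum L1 L2) f"
        "proj_image1 l f L1 \<noteq> {0\<^sub>v (lat_rank L1)}" "proj_image2 l f L2 \<noteq> {0\<^sub>v (lat_rank L2)}"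
      unfolding additively_indecomposable_def by blast
    then have "\<not> represents l E"
      using decomposable_not_represents[OF E(3)] l(2) E(2) by simp
    then show ?thesis using L(3) l by blast
  qed
  then have "n_universal n L"
    using assms(3) L(1) unfolding criterion_set_def by blast
  then show False using E L(2) unfolding n_universal_def by blast
qed

end
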